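(* Let $p\ge2$ be an integer and $\lambda$ a partition with $p$-core $\bar\lambda$ and $p$-quotient $\mu=(\mu^0,\dots,\mu^{p-1})$, $|\mu|=\sum_i|\mu^i|$. Then $$q_\lambda(x)=x^{|\bar\lambda|}R_\lambda(x^p)$$ where $R_\lambda$ is a monic polynomial of degree $|\mu|$ with non-vanishing constant coefficient $$R_\lambda(0)=(-1)^{h_\lambda}\frac{H_{\text{non-}p\text{-fold}}(\lambda)}{H(\bar\lambda)},\qquad h_\lambda=\mathrm{ht}_p(\lambda/\bar\lambda)+\frac{|\lambda|-|\bar\lambda|}{p}.$$
   Context: Fix an integer $p\ge2$. The polynomials $q_n$ ($n\ge0$) are defined by $\sum_{n\ge0}q_n(x)t^n/n!=\exp(tx-t^p/p)$. For a partition $\lambda=(\lambda_1\ge\dots\ge\lambda_{\ell(\lambda)}>0)$ with degree vector $n_i=\lambda_i+\ell(\lambda)-i$ and $\Delta(n_\lambda)=\prod_{i<j}(n_j-n_i)$, set $q_\lambda=\mathrm{Wr}[q_{n_1},\dots,q_{n_{\ell(\lambda)}}]/\Delta(n_\lambda)$ ($q_\emptyset=1$). A border strip of size $p$ in a Young diagram is a connected skew diagram of $p$ boxes containing no $2\times2$ square; removing one must leave a Young diagram. The $p$-core $\bar\lambda$ is the partition obtained by removing border strips of size $p$ as long as possible (it is independent of choices). The height of a removed border strip is its number of rows minus one, and $\mathrm{ht}_p(\lambda/\bar\lambda)$ is the sum of the heights of the strips removed in going from $\lambda$ to $\bar\lambda$ (well defined). The $p$-quotient is the $p$-tuple of partitions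 $(\mu^0,\dots,\mu^{p-1})$ where, for a Maya diagram $M=\{m+t: m\in M_\lambda\}$ ($t\ge0$, $M_\lambda=\{n<0\}\cup\{n_1,\dots,n_{\ell(\lambda)}\}$), $\mu^i$ is the partition of the Maya diagram $\{m:pm+i\in M\}$ (the partition of a Maya diagram $N$ having as parts the positive values of $\#\{n\notin N:n<m\}$, $m\in N$); the quotient is defined up to cyclic reordering, and $|\mu|=(|\lambda|-|\bar\lambda|)/p$. $H(\lambda)$ is the product of all hook lengths of $\lambda$ and $H_{\text{non-}p\text{-fold}}(\lambda)$ the product of the hook lengths not divisible by $p$. *)

theory Defs
  imports Complex_Main "HOL-Computational_Algebra.Polynomial" "HOL-Library.Multiset"
    "Jordan_Normal_Form.Determinant"
begin

definition is_partition :: "nat list \<Rightarrow> bool" where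
  "is_partition lam \<longleftrightarrow> sorted (rev lam) \<and> 0 \<notin> set lam"

definition psize :: "nat list \<Rightarrow> nat" where
  "psize lam = sum_list lam"

definition diagram :: "nat list \<Rightarrow> (nat \<times> nat) set" where
  "diagram lam = {(i, j). i < length lam \<and> j < lam ! i}"

(* degree vector n_i = lambda_i + l - i, with i 1-indexed; here 0-indexed *)
definition degvec :: "nat list \<Rightarrow> nat list" where
  "degvec lam = map (\<lambda>i. lam ! i + length lam - 1 - i) [0..<length lam]"

definition conj_part :: "nat list \<Rightarrow> nat \<Rightarrow> nat" where
  "conj_part lam j = card {k. k < length lam \<and> j < lam ! k}"

definition hook :: "nat list \<Rightarrow> nat \<Rightarrow> nat \<Rightarrow> nat" where
  "hook lam i j = (lam ! i - j) + (conj_part lam j - i) - 1"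

definition hook_prod :: "nat list \<Rightarrow> nat" where
  "hook_prod lam = (\<Prod>(i, j)\<in>diagram lam. hook lam i j)"

definition hook_prod_non_pfold :: "nat \<Rightarrow> nat list \<Rightarrow> nat" where
  "hook_prod_non_pfold p lam =
     (\<Prod>(i, j)\<in>{c \<in> diagram lam. \<not> p dvd hook lam (fst c) (snd c)}. hook lam i j)"

definition cell_adj :: "nat \<times> nat \<Rightarrow> nat \<times> nat \<Rightarrow> bool" where
  "cell_adj a b \<longleftrightarrow>
     (fst a = fst b \<and> (snd b = Suc (snd a) \<or> snd a = Suc (snd b))) \<or>
     (snd a = snd b \<and> (fst b = Suc (fst a) \<or> fst a = Suc (fst b)))"

definition cells_connected :: "(nat \<times> nat) set \<Rightarrow> bool" where
  "cells_connected S \<longleftrightarrow>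
     (\<forall>a\<in>S. \<forall>b\<in>S. (\<lambda>x y. x \<in> S \<and> y \<in> S \<and> cell_adj x y)\<^sup>*\<^sup>* a b)"

definition no_2x2 :: "(nat \<times> nat) set \<Rightarrow> bool" where
  "no_2x2 S \<longleftrightarrow>
     \<not> (\<exists>i j. (i, j) \<in> S \<and> (Suc i, j) \<in> S \<and> (i, Suc j) \<in> S \<and> (Suc i, Suc j) \<in> S)"

definition border_strip_removal :: "nat \<Rightarrow> nat list \<Rightarrow> nat list \<Rightarrow> bool" where
  "border_strip_removal p lam nu \<longleftrightarrow>
     is_partition nu \<and> diagram nu \<subseteq> diagram lam \<and>
     card (diagram lam - diagram nu) = p \<and>
     cells_connected (diagram lam - diagram nu) \<and> no_2x2 (diagram lam - diagram nu)"

definition strip_height :: "nat list \<Rightarrow> nat list \<Rightarrow> nat" where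
  "strip_height lam nu = card (fst ` (diagram lam - diagram nu)) - 1"

inductive core_chain :: "nat \<Rightarrow> nat list \<Rightarrow> nat list \<Rightarrow> nat \<Rightarrow> bool" where
  stop: "(\<nexists>nu. border_strip_removal p lam nu) \<Longrightarrow> core_chain p lam lam 0"
| step: "border_strip_removal p lam nu \<Longrightarrow> core_chain p nu c h \<Longrightarrow>
           core_chain p lam c (strip_height lam nu + h)"

definition maya :: "nat list \<Rightarrow> int set" where
  "maya lam = {n. n < 0} \<union> int ` set (degvec lam)"

definition maya_count :: "int set \<Rightarrow> int \<Rightarrow> nat" where
  "maya_count N m = card {n. n \<notin> N \<and> n < m}"

definition maya_partition :: "int set \<Rightarrow> nat multiset" where
  "maya_partition N = image_mset (maya_count N) (mset_set {m \<in> N. 0 < maya_count N m})"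

definition p_quotient :: "nat \<Rightarrow> nat \<Rightarrow> nat list \<Rightarrow> nat multiset list" where
  "p_quotient p t lam =
     (let M = (\<lambda>m. m + int t) ` maya lam in
      map (\<lambda>i. maya_partition {m. int p * m + int i \<in> M}) [0..<p])"

definition quotient_size :: "nat multiset list \<Rightarrow> nat" where
  "quotient_size mu = sum_list (map sum_mset mu)"

definition qpolys :: "nat \<Rightarrow> nat \<Rightarrow> real poly" where
  "qpolys p = (THE Q. \<forall>x t :: real.
      (\<lambda>n. poly (Q n) x * t ^ n / fact n) sums exp (t * x - t ^ p / real p))"

definition wronskian :: "real poly list \<Rightarrow> real poly" where
  "wronskian fs = det (mat (length fs) (length fs) (\<lambda>(i, j). (pderiv ^^ i) (fs ! j)))"

definition vandermonde_diff :: "nat list \<Rightarrow> real" where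
  "vandermonde_diff ns =
     (\<Prod>(i, j)\<in>{(i, j). i < j \<and> j < length ns}. real (ns ! j) - real (ns ! i))"

definition q_part :: "nat \<Rightarrow> nat list \<Rightarrow> real poly" where
  "q_part p lam =
     smult (1 / vandermonde_diff (degvec lam)) (wronskian (map (qpolys p) (degvec lam)))"

end

theory Submission
  imports Defs
begin

text \<open>
  Write \<open>q_n = n! h_n\<close>. Up to normalisation \<open>q_\<lambda>\<close> is the determinant \<open>S(n) = det (h_{n_j - i})\<close> in the
  degree vector \<open>n\<close>. Since \<open>k h_k = x h_k' - h_{k-p}\<close>, Euler's operator gives
  \<open>|\<lambda>| S(n) = x S'(n) - \<Sum>_j S(n - p e_j)\<close>, where the summand \<open>j\<close> vanishes if the new entry is negative or
  already present, and otherwise belongs to the removal of a border strip. Comparing coefficients of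
  \<open>x^k\<close> yields \<open>(|\<lambda>| - k) [x^k] S(n) = - \<Sum>_j [x^k] S(n - p e_j)\<close>, so by induction on \<open>|\<lambda>|\<close> only the exponents
  \<open>|core| + p s\<close> occur. The recursion for the lowest coefficient is solved by the product over the
  residue classes modulo \<open>p\<close> of Vandermonde products divided by factorials (the inverse of the
  product of the hook lengths divisible by \<open>p\<close>), because of the identity
  \<open>\<Sum>_y y \<Prod>_{z \<noteq> y} (1 - 1/(y - z)) = \<Sum>_y y - N (N - 1)/2\<close> for \<open>N\<close> distinct numbers \<open>y\<close>. The sign
  \<open>(-1)^ht\<close> is the change of sign of the Vandermonde product along the moves \<open>a \<mapsto> a - p\<close>.
\<close>

section \<open>The polynomials of the generating function\<close>

text \<open>The recursion is silent about the coefficient at the top exponent, where its left factor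
  vanishes. That coefficient is therefore computed directly, as a Vandermonde product over
  factorials. It makes R monic, and because lowest and top exponent coincide for a core, it is also
  the starting value for the lowest coefficient.

  The product that solves the recursion is suggested by the hook length formula. On the components
  of the quotient the recursion becomes the branching rule: the sum of 1/H(nu) over all nu obtained
  from mu by removing a box is |mu|/H(mu). The identity in the overview is this rule written in beta
  numbers, one residue class at a time.

  Sorting the vector after each move would bring a sign into every step of the recursion. With
  unsorted vectors its only sign is the explicit minus, which accumulates to (-1)^|mu|; the heights
  enter once, when the orders of the entries at the start and at the core are compared.\<close>

definition hpoly :: "nat \<Rightarrow> int \<Rightarrow> real poly" where
  "hpoly p k = (if k < 0 then 0 else
     (\<Sum>s\<le>nat k div p. monom ((-1 / real p) ^ s / (fact s * fact (nat k - p * s))) (nat k - p * s)))"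

text \<open>The exponent \<open>a\<close> determines \<open>s = (k - a) / p\<close>, so at most one
  term of the sum contributes. In this form, for an integer \<open>k\<close>, derivative and
  recurrence can be checked coefficient by coefficient.\<close>

lemma coeff_hpoly:
  assumes "p > 0"
  shows "coeff (hpoly p k) a =
    (if int a \<le> k \<and> int p dvd k - int a
     then (-1 / real p) ^ nat ((k - int a) div int p) / (fact (nat ((k - int a) div int p)) * fact a)
     else 0)"
proof (cases "k < 0")
  case True
  then show ?thesis by (simp add: hpoly_def)
next
  case False
  define m where "m = nat k"
  have k: "k = int m" using False by (simp add: m_def)
  let ?g = "\<lambda>s. (-1 / real p) ^ s / (fact s * fact (m - p * s)) :: real"
  have c: "coeff (hpoly p k) a = (\<Sum>s\<le>m div p. if a = m - p * s then ?g s else 0)"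
    by (auto simp: hpoly_def k coeff_sum intro!: sum.cong)
  show ?thesis
  proof (cases "a \<le> m \<and> p dvd m - a")
    case True
    then obtain s where s: "m - a = p * s" by blast
    have sa: "a = m - p * s" "p * s \<le> m" using True s by auto
    have sm: "s \<le> m div p"
      using sa(2) assms by (simp add: less_eq_div_iff_mult_less_eq mult.commute)
    have uniq: "(a = m - p * s') = (s' = s)" if "s' \<le> m div p" for s'
    proof -
      have "p * s' \<le> m" using that assms by (simp add: less_eq_div_iff_mult_less_eq mult.commute)
      then show ?thesis using sa assms by (metis diff_diff_cancel mult_cancel1 neq0_conv)
    qed
    have "coeff (hpoly p k) a = (\<Sum>s'\<le>m div p. if s' = s then ?g s' else 0)"
      unfolding c using uniq by (intro sum.cong) auto
    also have "\<dots> = ?g s" using sm by simp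
    finally have 1: "coeff (hpoly p k) a = ?g s" .
    have d: "k - int a = int p * int s" using s True k by (metis of_nat_diff of_nat_mult)
    then have "(k - int a) div int p = int s" using assms by simp
    then show ?thesis using 1 d True k sa by simp
  next
    case False
    have "a \<noteq> m - p * s" if "s \<le> m div p" for s
    proof
      assume "a = m - p * s"
      moreover have "p * s \<le> m" using that assms by (simp add: less_eq_div_iff_mult_less_eq mult.commute)
      ultimately show False using False by auto
    qed
    then have "coeff (hpoly p k) a = 0" unfolding c by (intro sum.neutral) auto
    moreover have "\<not> (int a \<le> k \<and> int p dvd k - int a)"
      using False k by (metis of_nat_diff of_nat_dvd_iff of_nat_le_iff)
    ultimately show ?thesis by (simp only: if_False)
  qed
qed

text \<open>Because \<open>hpoly\<close> is 0 at negative indices this holds for every integer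
  \<open>k\<close>, so an \<open>i\<close>-fold derivative is always a shift of the index by
  \<open>i\<close>, even past 0.\<close>

lemma pderiv_hpoly:
  assumes "p > 0"
  shows "pderiv (hpoly p k) = hpoly p (k - 1)"
proof (rule poly_eqI)
  fix a
  have e: "k - 1 - int a = k - int (Suc a)" by simp
  have l: "int a \<le> k - 1 \<longleftrightarrow> int (Suc a) \<le> k" by auto
  show "coeff (pderiv (hpoly p k)) a = coeff (hpoly p (k - 1)) a"
    unfolding coeff_pderiv coeff_hpoly[OF assms] e l
    by (auto simp: field_simps simp del: of_nat_Suc)
qed

text \<open>In the term with exponent \<open>a\<close> and index \<open>s\<close> one has
  \<open>k = a + p * s\<close>. The part \<open>a\<close> is Euler's operator; the part
  \<open>p * s\<close> cancels one factor of \<open>fact s\<close> and one \<open>1 / p\<close>,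
  which leaves minus the coefficient of \<open>hpoly p (k - p)\<close>.\<close>

lemma hpoly_recurrence:
  assumes "p > 0"
  shows "smult (of_int k) (hpoly p k) = monom 1 1 * pderiv (hpoly p k) - hpoly p (k - int p)"
proof (rule poly_eqI)
  fix a
  have 1: "coeff (monom 1 1 * pderiv (hpoly p k)) a = real a * coeff (hpoly p k) a"
    by (cases a) (auto simp: coeff_monom_mult coeff_pderiv)
  show "coeff (smult (of_int k) (hpoly p k)) a =
      coeff (monom 1 1 * pderiv (hpoly p k) - hpoly p (k - int p)) a"
  proof (cases "int a \<le> k \<and> int p dvd k - int a")
    case False
    have d: "int p dvd k - int p - int a \<longleftrightarrow> int p dvd k - int a"
      using dvd_add_times_triv_left_iff[of "int p" "-1" "k - int a"] by (simp add: algebra_simps)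
    from False have "coeff (hpoly p (k - int p)) a = 0"
      using d assms by (auto simp: coeff_hpoly[OF assms])
    then show ?thesis using False 1 by (auto simp: coeff_hpoly[OF assms])
  next
    case True
    then obtain s' where "k - int a = int p * s'" by blast
    moreover have "s' \<ge> 0" using calculation True assms
      by (metis diff_ge_0_iff_ge of_nat_0_less_iff zero_le_mult_iff not_less)
    ultimately obtain s where s: "k - int a = int p * int s" by (metis zero_le_imp_eq_int)
    have d: "(k - int a) div int p = int s" using s assms by simp
    have h: "coeff (hpoly p k) a = (-1 / real p) ^ s / (fact s * fact a)"
      using True d by (simp add: coeff_hpoly[OF assms])
    have k: "of_int k = real a + real p * real s" using s
      by (metis add.commute diff_add_cancel of_int_add of_int_mult of_int_of_nat_eq)
    show ?thesis
    proof (cases s)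
      case 0
      then have "coeff (hpoly p (k - int p)) a = 0" using s assms by (simp add: coeff_hpoly[OF assms])
      then show ?thesis using 1 k 0 by simp
    next
      case (Suc r)
      have e: "k - int p - int a = int p * int r" using s Suc by (simp add: algebra_simps)
      then have d': "(k - int p - int a) div int p = int r" using assms by simp
      have "int a \<le> k - int p" using e assms
        by (metis diff_ge_0_iff_ge of_nat_0_le_iff of_nat_mult)
      then have "coeff (hpoly p (k - int p)) a = (-1 / real p) ^ r / (fact r * fact a)"
        using e d' by (simp add: coeff_hpoly[OF assms])
      then have "real p * real s * coeff (hpoly p k) a = - coeff (hpoly p (k - int p)) a"
        unfolding h Suc using assms by (simp add: field_simps del: of_nat_Suc)
      then show ?thesis by (simp add: 1 k algebra_simps del: One_nat_def)
    qed
  qed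
qed

lemma degree_hpoly:
  assumes "p > 0"
  shows "degree (hpoly p (int m)) = m" "coeff (hpoly p (int m)) m = 1 / fact m"
proof -
  show c: "coeff (hpoly p (int m)) m = 1 / fact m" by (simp add: coeff_hpoly[OF assms])
  show "degree (hpoly p (int m)) = m"
  proof (rule antisym)
    show "degree (hpoly p (int m)) \<le> m" by (rule degree_le) (auto simp: coeff_hpoly[OF assms])
    show "m \<le> degree (hpoly p (int m))" by (rule le_degree) (simp add: c)
  qed
qed

text \<open>Uniqueness of the coefficients, needed because \<open>qpolys\<close> is a definite
  description.\<close>

lemma powser_coeffs_eq_0:
  fixes c :: "nat \<Rightarrow> real"
  assumes "\<And>t. (\<lambda>n. c n * t ^ n) sums 0"
  shows "c n = 0"
proof (induction n rule: less_induct)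
  case (less n)
  have "(\<lambda>k. c (k + n) * t ^ k) sums 0" if "t \<noteq> 0" for t
  proof -
    have "(\<lambda>k. c (k + n) * t ^ (k + n)) sums 0"
      using sums_split_initial_segment[OF assms[of t], of n] less by simp
    then have "(\<lambda>k. c (k + n) * t ^ (k + n) / t ^ n) sums (0 / t ^ n)" by (rule sums_divide)
    then show ?thesis using that by (simp add: power_add)
  qed
  \<comment> \<open>After the division by \<open>t ^ n\<close> the shifted series is known to vanish
    only for \<open>t \<noteq> 0\<close>, so its constant term is obtained as a limit at 0.\<close>
  then have "((\<lambda>_. 0) \<longlongrightarrow> c (0 + n)) (at (0::real))"
    by (intro powser_limit_0_strong[of 1 "\<lambda>k. c (k + n)" "\<lambda>_. 0"]) auto
  then show ?case by (simp add: tendsto_const_iff)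
qed

lemma hpoly_genfun:
  fixes x t :: real
  assumes "p \<ge> 2"
  shows "(\<lambda>n. poly (smult (fact n) (hpoly p (int n))) x * t ^ n / fact n) sums exp (t * x - t ^ p / real p)"
proof -
  have p: "p > 0" using assms by simp
  \<comment> \<open>\<open>a\<close> is the series of \<open>exp (- t ^ p / p)\<close> in powers of
    \<open>t\<close>, with zeros at the indices that are not multiples of \<open>p\<close>; its
    Cauchy product with the series \<open>b\<close> of \<open>exp (t * x)\<close> is the generating
    function.\<close>
  define a where "a n = (if p dvd n then (- (t ^ p) / real p) ^ (n div p) / fact (n div p) else 0)" for n
  define b where "b n = (t * x) ^ n / fact n" for n
  have g: "strict_mono ((*) p)" using p by (auto simp: strict_mono_def)
  have z: "n \<notin> range ((*) p) \<Longrightarrow> a n = 0" "n \<notin> range ((*) p) \<Longrightarrow> norm (a n) = 0" for n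
    by (auto simp: a_def dvd_def)
  have ap: "a (p * s) = (- (t ^ p) / real p) ^ s / fact s" for s using p by (simp add: a_def)
  have "(\<lambda>s. a (p * s)) sums exp (- (t ^ p) / real p)"
    unfolding ap using exp_converges[of "- (t ^ p) / real p"] by (simp add: divide_inverse mult.commute)
  then have e1: "a sums exp (- (t ^ p) / real p)"
    using sums_mono_reindex[of "(*) p" a] g z(1) by blast
  have "summable (\<lambda>s. norm (a (p * s)))"
    unfolding ap using summable_norm_exp[of "- (t ^ p) / real p"] by (simp add: divide_inverse mult.commute)
  then have na: "summable (\<lambda>n. norm (a n))"
    using summable_mono_reindex[of "(*) p" "\<lambda>n. norm (a n)"] g z(2) by blast
  have e2: "b sums exp (t * x)"
    using exp_converges[of "t * x"] by (simp add: b_def[abs_def] divide_inverse ac_simps)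
  have nb: "summable (\<lambda>n. norm (b n))"
    using summable_norm_exp[of "t * x"] by (simp add: b_def[abs_def] divide_inverse ac_simps)
  have "(\<lambda>k. \<Sum>i\<le>k. a i * b (k - i)) sums ((\<Sum>k. a k) * (\<Sum>k. b k))"
    by (rule Cauchy_product_sums[OF na nb])
  also have "(\<Sum>k. a k) * (\<Sum>k. b k) = exp (t * x - t ^ p / real p)"
    unfolding sums_unique[OF e1, symmetric] sums_unique[OF e2, symmetric] by (simp flip: exp_add)
  also have "(\<lambda>k. \<Sum>i\<le>k. a i * b (k - i)) =
      (\<lambda>n. poly (smult (fact n) (hpoly p (int n))) x * t ^ n / fact n)"
  proof
    fix n
    have "(\<Sum>i\<le>n. a i * b (n - i)) = (\<Sum>i\<in>(*) p ` {..n div p}. a i * b (n - i))"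
    proof (rule sum.mono_neutral_right)
      show "(*) p ` {..n div p} \<subseteq> {..n}" by (auto intro: order_trans[OF mult_le_mono2])
      show "\<forall>i\<in>{..n} - (*) p ` {..n div p}. a i * b (n - i) = 0"
      proof
        fix i assume i: "i \<in> {..n} - (*) p ` {..n div p}"
        have "\<not> p dvd i"
        proof
          assume "p dvd i"
          then obtain s where "i = p * s" by blast
          then show False using i p by (auto simp: less_eq_div_iff_mult_less_eq mult.commute)
        qed
        then show "a i * b (n - i) = 0" by (simp add: a_def)
      qed
    qed simp
    also have "\<dots> = (\<Sum>s\<le>n div p. a (p * s) * b (n - p * s))"
      using p by (subst sum.reindex) (auto simp: inj_on_def)
    also have "\<dots> = (\<Sum>s\<le>n div p. (-1 / real p) ^ s / (fact s * fact (n - p * s)) * x ^ (n - p * s)) * t ^ n"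
      unfolding sum_distrib_right
    proof (rule sum.cong[OF refl])
      fix s assume "s \<in> {..n div p}"
      then have le: "p * s \<le> n" using p by (simp add: less_eq_div_iff_mult_less_eq mult.commute)
      have "t ^ n = (t ^ p) ^ s * t ^ (n - p * s)"
        using le by (simp add: power_mult[symmetric] power_add[symmetric])
      moreover have "(- (t ^ p) / real p) ^ s = (-1 / real p) ^ s * (t ^ p) ^ s"
        by (simp add: power_mult_distrib[symmetric])
      ultimately show "a (p * s) * b (n - p * s) =
          (-1 / real p) ^ s / (fact s * fact (n - p * s)) * x ^ (n - p * s) * t ^ n"
        unfolding ap b_def by (simp add: power_mult_distrib)
    qed
    also have "\<dots> = poly (smult (fact n) (hpoly p (int n))) x * t ^ n / fact n"
      by (simp add: hpoly_def poly_sum poly_monom)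
    finally show "(\<Sum>i\<le>n. a i * b (n - i)) = poly (smult (fact n) (hpoly p (int n))) x * t ^ n / fact n" .
  qed
  finally show ?thesis .
qed

lemma qpolys_eq:
  assumes "p \<ge> 2"
  shows "qpolys p n = smult (fact n) (hpoly p (int n))"
proof -
  have "qpolys p = (\<lambda>n. smult (fact n) (hpoly p (int n)))"
    unfolding qpolys_def
  proof (rule the_equality, intro allI)
    fix x t :: real
    show "(\<lambda>n. poly (smult (fact n) (hpoly p (int n))) x * t ^ n / fact n) sums exp (t * x - t ^ p / real p)"
      by (rule hpoly_genfun[OF assms])
  next
    fix Q :: "nat \<Rightarrow> real poly"
    assume Q: "\<forall>x t. (\<lambda>n. poly (Q n) x * t ^ n / fact n) sums exp (t * x - t ^ p / real p)"
    show "Q = (\<lambda>n. smult (fact n) (hpoly p (int n)))"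
    proof
      fix n
      have "poly (Q n) x = poly (smult (fact n) (hpoly p (int n))) x" for x
      proof -
        let ?d = "\<lambda>n. (poly (Q n) x - poly (smult (fact n) (hpoly p (int n))) x) / fact n"
        have "(\<lambda>n. ?d n * t ^ n) sums 0" for t
        proof -
          have "(\<lambda>n. poly (Q n) x * t ^ n / fact n - poly (smult (fact n) (hpoly p (int n))) x * t ^ n / fact n)
              sums (exp (t * x - t ^ p / real p) - exp (t * x - t ^ p / real p))"
            using Q hpoly_genfun[OF assms, of x t] by (intro sums_diff) blast+
          then show ?thesis by (simp add: diff_divide_distrib left_diff_distrib)
        qed
        then have "?d n = 0" by (rule powser_coeffs_eq_0)
        then show ?thesis by simp
      qed
      then show "Q n = smult (fact n) (hpoly p (int n))" by (simp add: poly_eq_poly_eq_iff[symmetric] fun_eq_iff)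
    qed
  qed
  then show ?thesis by simp
qed

section \<open>Determinants of Jacobi-Trudi type\<close>

text \<open>Column \<open>j\<close> carries the degree \<open>n j\<close>, row \<open>i\<close> the
  number of derivatives: for \<open>h = hpoly p\<close> this is the Wronskian of the
  \<open>hpoly p (n j)\<close>. The entries of \<open>n\<close> are integers since
  \<open>n j - p\<close> may be negative, and the ring is left open because real values of
  \<open>h\<close> occur for leading coefficients.\<close>

definition jt :: "(int \<Rightarrow> 'a :: comm_ring_1) \<Rightarrow> nat \<Rightarrow> (nat \<Rightarrow> int) \<Rightarrow> 'a" where
  "jt h l n = det (mat l l (\<lambda>(i, j). h (n j - int i)))"

text \<open>The sum over all columns of the determinants in which that column is built from \<open>u\<close>
  instead of \<open>h\<close>; expanding over permutations replaces column operations by a rule for each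
  single term.\<close>

definition jt_deriv :: "(int \<Rightarrow> 'a :: comm_ring_1) \<Rightarrow> (int \<Rightarrow> 'a) \<Rightarrow> nat \<Rightarrow> (nat \<Rightarrow> int) \<Rightarrow> 'a" where
  "jt_deriv h u l n = (\<Sum>\<sigma> | \<sigma> permutes {0..<l}. signof \<sigma> *
     (\<Sum>i<l. u (n (\<sigma> i) - int i) * (\<Prod>i'\<in>{0..<l} - {i}. h (n (\<sigma> i') - int i'))))"

lemma jt_leibniz:
  "jt h l n = (\<Sum>\<sigma> | \<sigma> permutes {0..<l}. signof \<sigma> * (\<Prod>i=0..<l. h (n (\<sigma> i) - int i)))"
  unfolding jt_def det_def'[OF mat_carrier]
proof (intro sum.cong refl)
  fix \<sigma> assume "\<sigma> \<in> {\<sigma>. \<sigma> permutes {0..<l}}"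
  then have "\<sigma> i < l" if "i < l" for i using that permutes_in_image[of \<sigma> "{0..<l}" i] by simp
  then show "signof \<sigma> * (\<Prod>i=0..<l. mat l l (\<lambda>(i, j). h (n j - int i)) $$ (i, \<sigma> i)) =
      signof \<sigma> * (\<Prod>i=0..<l. h (n (\<sigma> i) - int i))" by simp
qed

text \<open>Homogeneity: the indices of the factors in the term of any permutation add up to the
  same number, the sum of all \<open>n j - j\<close>.\<close>

lemma jt_deriv_scale:
  assumes "\<And>k. u k = of_int k * h k"
  shows "jt_deriv h u l n = of_int (\<Sum>j<l. n j - int j) * jt h l n"
proof -
  have "(\<Sum>i<l. u (n (\<sigma> i) - int i) * (\<Prod>i'\<in>{0..<l} - {i}. h (n (\<sigma> i') - int i'))) =
      of_int (\<Sum>j<l. n j - int j) * (\<Prod>i=0..<l. h (n (\<sigma> i) - int i))"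
    if \<sigma>: "\<sigma> permutes {0..<l}" for \<sigma>
  proof -
    have "(\<Sum>i<l. u (n (\<sigma> i) - int i) * (\<Prod>i'\<in>{0..<l} - {i}. h (n (\<sigma> i') - int i'))) =
        (\<Sum>i<l. of_int (n (\<sigma> i) - int i) * (\<Prod>i=0..<l. h (n (\<sigma> i) - int i)))"
      by (intro sum.cong refl, subst prod.remove[where A = "{0..<l}"]) (auto simp: assms mult.assoc)
    also have "\<dots> = of_int (\<Sum>i<l. n (\<sigma> i) - int i) * (\<Prod>i=0..<l. h (n (\<sigma> i) - int i))"
      by (simp only: of_int_sum sum_distrib_right)
    also have "(\<Sum>i<l. n (\<sigma> i) - int i) = (\<Sum>j<l. n j - int j)"
      using sum.permute[OF \<sigma>, of n] by (simp add: sum_subtractf lessThan_atLeast0 comp_def)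
    finally show ?thesis .
  qed
  then show ?thesis
    unfolding jt_deriv_def jt_leibniz
    by (subst sum_distrib_left, intro sum.cong refl) (simp only: mem_Collect_eq mult.left_commute)
qed

text \<open>In the term of \<sigma>, lowering \<open>n j\<close> affects only the factor in the row
  that \<sigma> sends to \<open>j\<close>. Summing over columns is thus the same as summing over
  rows.\<close>

lemma jt_deriv_shift:
  "(\<Sum>j<l. jt h l (n(j := n j - d))) = jt_deriv h (\<lambda>k. h (k - d)) l n"
proof -
  have "(\<Sum>j<l. \<Prod>i=0..<l. h ((n(j := n j - d)) (\<sigma> i) - int i)) =
      (\<Sum>i<l. h (n (\<sigma> i) - int i - d) * (\<Prod>i'\<in>{0..<l} - {i}. h (n (\<sigma> i') - int i')))"
    if \<sigma>: "\<sigma> permutes {0..<l}" for \<sigma>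
  proof -
    \<comment> \<open>The column \<open>j\<close> is renamed to the image of row \<open>k\<close>
      under \<sigma>.\<close>
    have "(\<Sum>j<l. \<Prod>i=0..<l. h ((n(j := n j - d)) (\<sigma> i) - int i)) =
        (\<Sum>k<l. \<Prod>i=0..<l. h ((n(\<sigma> k := n (\<sigma> k) - d)) (\<sigma> i) - int i))"
      unfolding lessThan_atLeast0 by (rule sum.permute[OF \<sigma>, THEN trans]) (simp only: comp_def)
    also have "\<dots> = (\<Sum>i<l. h (n (\<sigma> i) - int i - d) * (\<Prod>i'\<in>{0..<l} - {i}. h (n (\<sigma> i') - int i')))"
    proof (intro sum.cong refl)
      fix k assume k: "k \<in> {..<l}"
      have "h (n (\<sigma> k) - d - int k) = h (n (\<sigma> k) - int k - d)" by (simp add: algebra_simps)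
      moreover have "(\<Prod>i\<in>{0..<l} - {k}. h ((n(\<sigma> k := n (\<sigma> k) - d)) (\<sigma> i) - int i)) =
          (\<Prod>i\<in>{0..<l} - {k}. h (n (\<sigma> i) - int i))"
        using permutes_inj[OF \<sigma>] by (intro prod.cong) (auto simp: inj_eq)
      moreover have "(\<Prod>i=0..<l. h ((n(\<sigma> k := n (\<sigma> k) - d)) (\<sigma> i) - int i)) =
          h (n (\<sigma> k) - d - int k) * (\<Prod>i\<in>{0..<l} - {k}. h ((n(\<sigma> k := n (\<sigma> k) - d)) (\<sigma> i) - int i))"
        using k prod.remove[of "{0..<l}" k "\<lambda>i. h ((n(\<sigma> k := n (\<sigma> k) - d)) (\<sigma> i) - int i)"] by simp
      ultimately show "(\<Prod>i=0..<l. h ((n(\<sigma> k := n (\<sigma> k) - d)) (\<sigma> i) - int i)) =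
          h (n (\<sigma> k) - int k - d) * (\<Prod>i'\<in>{0..<l} - {k}. h (n (\<sigma> i') - int i'))"
        by (simp only:)
    qed
    finally show ?thesis .
  qed
  then show ?thesis
    unfolding jt_deriv_def jt_leibniz
    by (subst sum.swap, intro sum.cong refl) (simp only: mem_Collect_eq sum_distrib_left[symmetric])
qed

lemma jt_deriv_linear:
  "jt_deriv h (\<lambda>k. c * u k - v k) l n = c * jt_deriv h u l n - jt_deriv h v l n"
  unfolding jt_deriv_def
  by (simp only: left_diff_distrib sum_subtractf right_diff_distrib sum_distrib_left mult.assoc
      mult.left_commute[of _ c])

lemma pderiv_jt:
  fixes h :: "int \<Rightarrow> real poly"
  shows "pderiv (jt h l n) = jt_deriv h (\<lambda>k. pderiv (h k)) l n"
proof -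
  have s: "pderiv (signof \<sigma> * q) = signof \<sigma> * pderiv q" for \<sigma> :: "nat \<Rightarrow> nat" and q :: "real poly"
    by (cases "evenperm \<sigma>") (auto simp: sign_def pderiv_minus)
  have ps: "pderiv (\<Sum>a\<in>S. f a) = (\<Sum>a\<in>S. pderiv (f a))" for f :: "(nat \<Rightarrow> nat) \<Rightarrow> real poly" and S
    by (induction S rule: infinite_finite_induct) (auto simp: pderiv_add)
  show ?thesis
    unfolding jt_deriv_def jt_leibniz ps s
    by (intro sum.cong refl) (simp add: pderiv_prod mult.commute lessThan_atLeast0)
qed

text \<open>\<open>jt_deriv\<close> is linear in the replacing function, so the recurrence of the
  single polynomials carries over to determinants. For \<open>k\<close> equal to the sum of all
  \<open>n j - j\<close> the left side is 0 and nothing is learnt about that coefficient.\<close>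

lemma jt_hpoly_recurrence:
  assumes "p > 0"
  shows "(of_int (\<Sum>j<l. n j - int j) - real k) * coeff (jt (hpoly p) l n) k =
    - (\<Sum>j<l. coeff (jt (hpoly p) l (n(j := n j - int p))) k)"
proof -
  have r: "of_int k * hpoly p k = monom 1 1 * pderiv (hpoly p k) - hpoly p (k - int p)" for k
    using hpoly_recurrence[OF assms, of k] by (simp add: of_int_poly)
  have "of_int (\<Sum>j<l. n j - int j) * jt (hpoly p) l n = jt_deriv (hpoly p) (\<lambda>k. of_int k * hpoly p k) l n"
    by (rule jt_deriv_scale[symmetric]) simp
  also have "\<dots> = monom 1 1 * pderiv (jt (hpoly p) l n) - (\<Sum>j<l. jt (hpoly p) l (n(j := n j - int p)))"
    unfolding r jt_deriv_linear pderiv_jt jt_deriv_shift ..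
  finally have "coeff (of_int (\<Sum>j<l. n j - int j) * jt (hpoly p) l n) k =
      coeff (monom 1 1 * pderiv (jt (hpoly p) l n)) k - (\<Sum>j<l. coeff (jt (hpoly p) l (n(j := n j - int p))) k)"
    by (simp only: coeff_diff coeff_sum)
  moreover have "coeff (monom 1 1 * pderiv q) k = real k * coeff q k" for q :: "real poly"
    by (cases k) (auto simp: coeff_monom_mult coeff_pderiv)
  moreover have "coeff (of_int c * q) k = of_int c * coeff q k" for c and q :: "real poly"
    by (simp add: of_int_poly)
  ultimately show ?thesis by (simp only: left_diff_distrib)
qed

lemma jt_eq_0_repeated:
  assumes "j < k" "k < l" "n j = n k"
  shows "jt h l n = 0"
  unfolding jt_def using assms
  by (intro det_identical_columns[of _ l j k]) (auto intro!: eq_vecI)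

text \<open>Indices only decrease down a column, so a negative \<open>n j\<close> makes all of
  column \<open>j\<close> zero.\<close>

lemma jt_eq_0_negative:
  assumes "j < l" "n j < 0" "\<And>k. k < 0 \<Longrightarrow> h k = 0"
  shows "jt h l n = 0"
  unfolding jt_leibniz
proof (intro sum.neutral ballI)
  fix \<sigma> assume "\<sigma> \<in> {\<sigma>. \<sigma> permutes {0..<l}}"
  then have \<sigma>: "\<sigma> permutes {0..<l}" by simp
  obtain i where i: "i < l" "\<sigma> i = j"
    using permutes_image[OF \<sigma>] assms(1) by (metis atLeastLessThan_iff imageE zero_le)
  have "(\<Prod>i=0..<l. h (n (\<sigma> i) - int i)) = 0"
    using i assms by (intro prod_zero) (auto intro!: bexI[of _ i])
  then show "signof \<sigma> * (\<Prod>i=0..<l. h (n (\<sigma> i) - int i)) = 0" by simp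
qed

text \<open>Induction on the size: as a function of its last variable the determinant is a
  polynomial of degree at most \<open>l\<close> that vanishes at the other variables, and its
  coefficient at \<open>l\<close> is the smaller determinant. If these variables are not distinct,
  both sides are 0.\<close>

lemma monic_vandermonde:
  fixes P :: "nat \<Rightarrow> 'a :: field poly"
  assumes "\<And>i. degree (P i) = i" "\<And>i. lead_coeff (P i) = 1"
  shows "det (mat l l (\<lambda>(i, j). poly (P i) (x j))) = (\<Prod>j<l. \<Prod>i<j. x j - x i)"
proof (induction l)
  case 0
  then show ?case by simp
next
  case (Suc l)
  \<comment> \<open>The last column gets a free variable \<open>y\<close>. The cofactors along this
    column do not involve \<open>y\<close>, so they may be taken from \<open>?A 0\<close>.\<close>
  let ?A = "\<lambda>y. mat (Suc l) (Suc l) (\<lambda>(i, j). poly (P i) (if j = l then y else x j))"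
  define V where "V = (\<Prod>j<l. \<Prod>i<j. x j - x i)"
  define Q where "Q = (\<Sum>i<Suc l. smult (cofactor (?A 0) i l) (P i))"
  have del: "mat_delete (?A y) i l = mat_delete (?A 0) i l" if "i \<le> l" for y i
    using that by (intro eq_matI) (auto simp: mat_delete_def)
  have Q: "poly Q y = det (?A y)" for y
  proof -
    have "det (?A y) = (\<Sum>i<Suc l. ?A y $$ (i, l) * cofactor (?A y) i l)"
      by (rule laplace_expansion_column) auto
    also have "\<dots> = (\<Sum>i<Suc l. poly (P i) y * cofactor (?A 0) i l)"
      by (intro sum.cong) (auto simp: cofactor_def del[of _ y])
    also have "\<dots> = poly Q y" by (simp add: Q_def poly_sum mult.commute)
    finally show ?thesis ..
  qed
  have "mat_delete (?A 0) l l = mat l l (\<lambda>(i, j). poly (P i) (x j))"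
    by (intro eq_matI) (auto simp: mat_delete_def)
  then have cl: "cofactor (?A 0) l l = V" using Suc by (simp add: cofactor_def V_def)
  have goal: "poly Q (x l) = V * (\<Prod>i<l. x l - x i)"
  proof (cases "inj_on x {..<l}")
    case False
    then obtain a b where ab: "a < b" "b < l" "x a = x b"
      using linorder_inj_onI'[of "{..<l}" x] by force
    then have "(\<Prod>i<b. x b - x i) = 0" by (intro prod_zero) (auto intro!: bexI[of _ a])
    then have "V = 0" unfolding V_def using ab by (intro prod_zero) auto
    moreover have "det (?A (x l)) = 0"
      using ab by (intro det_identical_columns[of _ "Suc l" a b]) (auto intro!: eq_vecI)
    ultimately show ?thesis by (simp add: Q)
  next
    case True
    define D where "D = (\<Prod>i<l. [:- x i, 1:])"
    have "degree D = (\<Sum>i<l. degree [:- x i, 1:])"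
      unfolding D_def by (rule degree_prod_eq_sum_degree) simp
    moreover have "lead_coeff D = 1" unfolding D_def lead_coeff_prod by simp
    ultimately have D: "degree D = l" "lead_coeff D = 1" by simp_all
    \<comment> \<open>The difference has the \<open>l\<close> distinct roots \<open>x a\<close>,
      while its coefficients from \<open>l\<close> on cancel.\<close>
    have "Q - smult V D = 0"
    proof (rule ccontr)
      assume nz: "Q - smult V D \<noteq> 0"
      have root: "poly (Q - smult V D) (x a) = 0" if "a < l" for a
      proof -
        have "det (?A (x a)) = 0"
          using that by (intro det_identical_columns[of _ "Suc l" a l]) (auto intro!: eq_vecI)
        moreover have "poly D (x a) = 0" using that by (auto simp: D_def poly_prod intro!: prod_zero)
        ultimately show ?thesis by (simp add: Q)
      qed
      have "l = card (x ` {..<l})" using True by (simp add: card_image)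
      also have "\<dots> \<le> card {y. poly (Q - smult V D) y = 0}"
        using root by (intro card_mono poly_roots_finite[OF nz]) auto
      also have "\<dots> \<le> degree (Q - smult V D)" by (rule card_poly_roots_bound[OF nz])
      finally have deg: "l \<le> degree (Q - smult V D)" .
      have ge: "coeff (Q - smult V D) k = 0" if "k \<ge> l" for k
      proof -
        have "coeff Q k = (\<Sum>i<Suc l. cofactor (?A 0) i l * coeff (P i) k)"
          by (simp add: Q_def coeff_sum)
        also have "\<dots> = cofactor (?A 0) l l * coeff (P l) k"
          using that assms(1) by (simp add: coeff_eq_0)
        finally have q: "coeff Q k = V * coeff (P l) k" by (simp add: cl)
        have "coeff (P l) k = coeff D k"
          using that D assms[of l] by (cases "k = l") (auto simp: coeff_eq_0)
        then show ?thesis using q by simp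
      qed
      then show False using ge[OF deg] nz leading_coeff_0_iff by blast
    qed
    then have "Q = smult V D" by simp
    then show ?thesis by (simp add: D_def poly_prod)
  qed
  have "det (mat (Suc l) (Suc l) (\<lambda>(i, j). poly (P i) (x j))) = det (?A (x l))"
    by (intro arg_cong[of _ _ det] eq_matI) auto
  also have "\<dots> = V * (\<Prod>i<l. x l - x i)" using goal Q by simp
  finally show ?case by (simp add: V_def)
qed

section \<open>Products over pairs of entries\<close>

definition pairs_prod :: "nat \<Rightarrow> (nat \<Rightarrow> nat \<Rightarrow> 'a :: comm_monoid_mult) \<Rightarrow> 'a" where
  "pairs_prod l f = (\<Prod>k<l. \<Prod>i<k. f i k)"

lemma pairs_prod_mult: "pairs_prod l (\<lambda>i k. f i k * g i k) = pairs_prod l f * pairs_prod l g"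
  by (simp add: pairs_prod_def prod.distrib)

lemma pairs_prod_cong:
  "(\<And>i k. i < k \<Longrightarrow> k < l \<Longrightarrow> f i k = g i k) \<Longrightarrow> pairs_prod l f = pairs_prod l g"
  by (simp add: pairs_prod_def)

lemma pairs_prod_zero:
  fixes f :: "nat \<Rightarrow> nat \<Rightarrow> 'a :: comm_semiring_1"
  assumes "i < k" "k < l" "f i k = 0"
  shows "pairs_prod l f = 0"
proof -
  have "(\<Prod>i<k. f i k) = 0" using assms by (intro prod_zero) auto
  then show ?thesis unfolding pairs_prod_def using assms by (intro prod_zero) auto
qed

text \<open>Used when a single entry \<open>j\<close> changes: the correction factors of the pairs
  through \<open>j\<close>, whichever side \<open>j\<close> stands on, combine to a product over all
  other indices.\<close>

lemma pairs_prod_through: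
  assumes "j < l"
  shows "pairs_prod l (\<lambda>i k. if i = j then f k else if k = j then f i else 1) = (\<Prod>k\<in>{..<l} - {j}. f k)"
proof -
  have inner: "(\<Prod>i<k. if i = j then f k else if k = j then f i else 1) =
      (if j < k then f k else if k = j then \<Prod>i<j. f i else 1)" for k
  proof (cases "k = j")
    case False
    then have "(\<Prod>i<k. if i = j then f k else if k = j then f i else 1) = (\<Prod>i<k. if i = j then f k else 1)"
      by (intro prod.cong) auto
    also have "\<dots> = (if j < k then f k else 1)" by (simp add: prod.delta)
    finally have e: "(\<Prod>i<k. if i = j then f k else if k = j then f i else 1) = (if j < k then f k else 1)" .
    show ?thesis unfolding e using False by simp
  qed simp
  have split: "{..<l} - {j} = {..<j} \<union> {j<..<l}" "{..<l} = {..<j} \<union> insert j {j<..<l}"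
    using assms by auto
  have "(\<Prod>k\<in>{..<l} - {j}. f k) = (\<Prod>i<j. f i) * (\<Prod>k\<in>{j<..<l}. f k)"
    unfolding split(1) by (rule prod.union_disjoint) auto
  moreover have "pairs_prod l (\<lambda>i k. if i = j then f k else if k = j then f i else 1) =
      (\<Prod>k<j. if j < k then f k else if k = j then \<Prod>i<j. f i else 1) *
      (\<Prod>k\<in>insert j {j<..<l}. if j < k then f k else if k = j then \<Prod>i<j. f i else 1)"
    unfolding pairs_prod_def inner split(2) by (rule prod.union_disjoint) auto
  moreover have "(\<Prod>k<j. if j < k then f k else if k = j then \<Prod>i<j. f i else 1) = 1"
    by (rule prod.neutral) auto
  moreover have "(\<Prod>k\<in>{j<..<l}. if j < k then f k else if k = j then \<Prod>i<j. f i else 1) =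
      (\<Prod>k\<in>{j<..<l}. f k)"
    by (rule prod.cong) auto
  ultimately show ?thesis by simp
qed

text \<open>The signed product Delta(n). For distinct entries its sign is the parity of the number
  of pairs in decreasing order, so it remembers how the entries are arranged.\<close>

definition vdm :: "nat \<Rightarrow> (nat \<Rightarrow> nat) \<Rightarrow> real" where
  "vdm l n = pairs_prod l (\<lambda>i j. real (n j) - real (n i))"

text \<open>The falling factorial m(m-1)...(m-i+1) is m!/(m-i)!, and it vanishes for i > m, in
  agreement with the convention that inverse factorials of negative numbers are 0.\<close>

lemma poly_falling_factorial:
  "poly (\<Prod>k<i. [:- real k, 1:]) (real m) =
    fact m * (if int m - int i < 0 then 0 else 1 / fact (nat (int m - int i)))"
proof (induction i)
  case (Suc i)
  show ?case
  proof (cases "Suc i \<le> m")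
    case True
    have e: "nat (int m - int i) = Suc (nat (int m - int (Suc i)))" using True by simp
    have r: "real m - real i = real (Suc (nat (int m - int (Suc i))))" using True by simp
    have "poly (\<Prod>k<Suc i. [:- real k, 1:]) (real m) =
        fact m / fact (nat (int m - int i)) * (real m - real i)"
      using Suc True by (simp add: diff_divide_distrib algebra_simps)
    also have "\<dots> = fact m * (1 / fact (nat (int m - int (Suc i))))"
      unfolding e r fact_Suc by (simp add: field_simps del: of_nat_Suc)
    finally show ?thesis using True by simp
  next
    case False
    have "poly (\<Prod>k<Suc i. [:- real k, 1:]) (real m) = poly (\<Prod>k<i. [:- real k, 1:]) (real m) * (real m - real i)"
      by (simp add: algebra_simps)
    also have "\<dots> = 0"
    proof (cases "i = m")
      case False
      with \<open>\<not> Suc i \<le> m\<close> have "m < i" by simp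
      then show ?thesis by (simp add: Suc)
    qed simp
    finally show ?thesis using False by simp
  qed
qed simp

text \<open>Multiplying column \<open>j\<close> by \<open>fact (n j)\<close> turns its entries into
  falling factorials, monic polynomials in \<open>n j\<close> whose degree is the row index.\<close>

lemma jt_inverse_factorials:
  "jt (\<lambda>k. if k < 0 then 0 else 1 / fact (nat k)) l (\<lambda>j. int (n j)) = vdm l n / (\<Prod>j<l. fact (n j))"
proof -
  define g :: "int \<Rightarrow> real" where "g k = (if k < 0 then 0 else 1 / fact (nat k))" for k
  define P :: "nat \<Rightarrow> real poly" where "P i = (\<Prod>k<i. [:- real k, 1:])" for i
  have P: "poly (P i) (real m) = fact m * g (int m - int i)" for i m
    by (simp only: P_def g_def poly_falling_factorial)
  have "degree (P i) = i" for i
    unfolding P_def by (subst degree_prod_eq_sum_degree) auto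
  moreover have "lead_coeff (P i) = 1" for i
    unfolding P_def lead_coeff_prod by simp
  ultimately have "vdm l n = det (mat l l (\<lambda>(i, j). poly (P i) (real (n j))))"
    unfolding vdm_def pairs_prod_def by (rule monic_vandermonde[symmetric])
  also have "\<dots> = (\<Sum>\<sigma> | \<sigma> permutes {0..<l}. signof \<sigma> * (\<Prod>i=0..<l. fact (n (\<sigma> i)) * g (int (n (\<sigma> i)) - int i)))"
    unfolding det_def'[OF mat_carrier]
  proof (intro sum.cong refl)
    fix \<sigma> assume "\<sigma> \<in> {\<sigma>. \<sigma> permutes {0..<l}}"
    then have "\<sigma> i < l" if "i < l" for i using that permutes_in_image[of \<sigma> "{0..<l}" i] by simp
    then show "signof \<sigma> * (\<Prod>i=0..<l. mat l l (\<lambda>(i, j). poly (P i) (real (n j))) $$ (i, \<sigma> i)) =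
        signof \<sigma> * (\<Prod>i=0..<l. fact (n (\<sigma> i)) * g (int (n (\<sigma> i)) - int i))"
      by (simp add: P)
  qed
  also have "\<dots> = (\<Sum>\<sigma> | \<sigma> permutes {0..<l}. (\<Prod>j<l. fact (n j)) *
      (signof \<sigma> * (\<Prod>i=0..<l. g (int (n (\<sigma> i)) - int i))))"
  proof (intro sum.cong refl)
    fix \<sigma> assume "\<sigma> \<in> {\<sigma>. \<sigma> permutes {0..<l}}"
    then have "(\<Prod>i=0..<l. fact (n (\<sigma> i)) :: real) = (\<Prod>j<l. fact (n j))"
      using prod.permute[of \<sigma> "{0..<l}" "\<lambda>j. fact (n j) :: real"] by (simp add: lessThan_atLeast0 comp_def)
    then show "signof \<sigma> * (\<Prod>i=0..<l. fact (n (\<sigma> i)) * g (int (n (\<sigma> i)) - int i)) =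
        (\<Prod>j<l. fact (n j)) * (signof \<sigma> * (\<Prod>i=0..<l. g (int (n (\<sigma> i)) - int i)))"
      by (simp add: prod.distrib)
  qed
  also have "\<dots> = (\<Prod>j<l. fact (n j)) * jt g l (\<lambda>j. int (n j))"
    unfolding jt_leibniz sum_distrib_left ..
  finally have "vdm l n = (\<Prod>j<l. fact (n j)) * jt g l (\<lambda>j. int (n j))" .
  moreover have "(\<Prod>j<l. fact (n j) :: real) \<noteq> 0" by simp
  ultimately have "jt g l (\<lambda>j. int (n j)) = vdm l n / (\<Prod>j<l. fact (n j))" by simp
  then show ?thesis by (simp only: g_def[abs_def])
qed

text \<open>In each permutation term without a negative index the degrees of the factors add up to
  \<open>k\<close>, so this coefficient is the product of the leading coefficients
  \<open>1 / fact\<close>; terms with a negative index vanish on both sides.\<close>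

lemma coeff_jt_hpoly_top:
  assumes "p > 0" and k: "int k = (\<Sum>j<l. int (n j) - int j)"
  shows "coeff (jt (hpoly p) l (\<lambda>j. int (n j))) k = vdm l n / (\<Prod>j<l. fact (n j))"
proof -
  define g :: "int \<Rightarrow> real" where "g k = (if k < 0 then 0 else 1 / fact (nat k))" for k
  have t: "coeff (signof \<sigma> * q) k = signof \<sigma> * coeff q k" for \<sigma> :: "nat \<Rightarrow> nat" and q :: "real poly"
    by (cases "evenperm \<sigma>") (auto simp: sign_def)
  have "coeff (\<Prod>i=0..<l. hpoly p (int (n (\<sigma> i)) - int i)) k = (\<Prod>i=0..<l. g (int (n (\<sigma> i)) - int i))"
    if \<sigma>: "\<sigma> permutes {0..<l}" for \<sigma>
  proof (cases "\<exists>i<l. int (n (\<sigma> i)) - int i < 0")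
    case True
    then obtain i where i: "i < l" "int (n (\<sigma> i)) - int i < 0" by blast
    have "(\<Prod>i=0..<l. hpoly p (int (n (\<sigma> i)) - int i)) = 0"
      using i by (intro prod_zero) (auto simp: hpoly_def intro!: bexI[of _ i])
    moreover have "(\<Prod>i=0..<l. g (int (n (\<sigma> i)) - int i)) = 0"
      using i by (intro prod_zero) (auto simp: g_def intro!: bexI[of _ i])
    ultimately show ?thesis by (simp only: coeff_0)
  next
    case False
    define m where "m i = n (\<sigma> i) - i" for i
    have m: "int (n (\<sigma> i)) - int i = int (m i)" if "i < l" for i
    proof -
      have "i \<le> n (\<sigma> i)" using False that by force
      then show ?thesis by (simp add: m_def)
    qed
    have nz: "hpoly p (int q) \<noteq> 0" for q using degree_hpoly(2)[OF assms(1), of q] by auto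
    have "int k = (\<Sum>i=0..<l. int (n (\<sigma> i)) - int i)"
      unfolding k using sum.permute[OF \<sigma>, of "\<lambda>j. int (n j)"]
      by (simp add: sum_subtractf lessThan_atLeast0 comp_def)
    also have "\<dots> = int (\<Sum>i=0..<l. m i)" by (simp add: m)
    finally have km: "k = (\<Sum>i=0..<l. m i)" by (simp only: of_nat_eq_iff)
    have "degree (\<Prod>i=0..<l. hpoly p (int (m i))) = k"
      unfolding km by (subst degree_prod_eq_sum_degree) (auto simp: nz degree_hpoly[OF assms(1)])
    then have "coeff (\<Prod>i=0..<l. hpoly p (int (m i))) k = lead_coeff (\<Prod>i=0..<l. hpoly p (int (m i)))"
      by simp
    also have "\<dots> = (\<Prod>i=0..<l. g (int (m i)))"
      unfolding lead_coeff_prod by (simp add: degree_hpoly[OF assms(1)] g_def)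
    finally show ?thesis by (simp add: m)
  qed
  then have "coeff (jt (hpoly p) l (\<lambda>j. int (n j))) k = jt g l (\<lambda>j. int (n j))"
    unfolding jt_leibniz coeff_sum t by (intro sum.cong refl) simp
  then show ?thesis by (simp only: g_def[abs_def] jt_inverse_factorials)
qed

section \<open>Partial fractions and the weighted sum over distinct numbers\<close>

lemma partial_fraction_step:
  fixes a b c :: "'a :: field"
  assumes "a \<noteq> 0" "b \<noteq> 0" "a + b \<noteq> 0"
  shows "(1 - 1 / b) * c / a = c / a - c / a / (a + b) + c / (- b) / (a + b)"
proof -
  have "c / a + c / b = (a + b) * (c / (a * b))" using assms by (simp add: field_simps)
  then have "(c / a + c / b) / (a + b) = c / (a * b)" using assms by simp
  then have "c / a / (a + b) = c / (a * b) - c / b / (a + b)"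
    by (simp only: add_divide_distrib eq_diff_eq)
  moreover have "(1 - 1 / b) * c / a = c / a - c / (a * b)" using assms by (simp add: field_simps)
  ultimately show ?thesis by simp
qed

text \<open>With P(u) the product of all u - y_k, the left side is P(u-1)/P(u). It tends to 1 at
  infinity and has simple poles at the y_k, whose residues are the negatives of the products on the
  right. In the induction \<open>u\<close> is arbitrary since the hypothesis is also used at the new
  pole \<open>y v\<close>.\<close>

lemma partial_fraction_shift:
  fixes y :: "'i \<Rightarrow> 'a :: field"
  assumes "finite J" "inj_on y J" "u \<notin> y ` J"
  shows "(\<Prod>k\<in>J. 1 - 1 / (u - y k)) = 1 - (\<Sum>k\<in>J. (\<Prod>i\<in>J - {k}. 1 - 1 / (y k - y i)) / (u - y k))"
  using assms
proof (induction J arbitrary: u rule: finite_induct)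
  case (insert v J)
  define c where "c k = (\<Prod>i\<in>J - {k}. 1 - 1 / (y k - y i))" for k
  have ne: "u \<noteq> y v" "\<And>k. k \<in> J \<Longrightarrow> u \<noteq> y k" "\<And>k. k \<in> J \<Longrightarrow> y k \<noteq> y v" "\<And>k. k \<in> J \<Longrightarrow> y v \<noteq> y k"
    using insert.prems insert.hyps by (auto simp: inj_on_insert image_iff)
  have IH: "(\<Prod>k\<in>J. 1 - 1 / (w - y k)) = 1 - (\<Sum>k\<in>J. c k / (w - y k))" if "w \<notin> y ` J" for w
    unfolding c_def using that insert.prems by (intro insert.IH) (auto simp: inj_on_def)
  have ck: "(\<Prod>i\<in>insert v J - {k}. 1 - 1 / (y k - y i)) = (1 - 1 / (y k - y v)) * c k" if "k \<in> J" for k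
  proof -
    have "insert v J - {k} = insert v (J - {k})" using that insert.hyps by auto
    then show ?thesis using insert.hyps by (simp add: c_def)
  qed
  have cv: "(\<Prod>i\<in>J. 1 - 1 / (y v - y i)) = 1 - (\<Sum>k\<in>J. c k / (y v - y k))"
    using IH[of "y v"] ne by force
  have "(\<Sum>k\<in>J. (1 - 1 / (y k - y v)) * c k / (u - y k)) =
      (\<Sum>k\<in>J. c k / (u - y k) - (c k / (u - y k)) / (u - y v) + c k / (y v - y k) / (u - y v))"
  proof (intro sum.cong refl)
    fix k assume "k \<in> J"
    then have "u - y k \<noteq> 0" "y k - y v \<noteq> 0" "(u - y k) + (y k - y v) \<noteq> 0"
      using ne by simp_all
    \<comment> \<open>Here \<open>a = u - y k\<close> and \<open>b = y k - y v\<close>, hence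
      \<open>a + b = u - y v\<close>.\<close>
    from partial_fraction_step[OF this, of "c k"] show "(1 - 1 / (y k - y v)) * c k / (u - y k) =
        c k / (u - y k) - (c k / (u - y k)) / (u - y v) + c k / (y v - y k) / (u - y v)"
      by simp
  qed
  also have "\<dots> = (\<Sum>k\<in>J. c k / (u - y k)) - (\<Sum>k\<in>J. c k / (u - y k)) / (u - y v)
      + (\<Sum>k\<in>J. c k / (y v - y k)) / (u - y v)"
    by (simp add: sum.distrib sum_subtractf sum_divide_distrib)
  finally have s: "(\<Sum>k\<in>J. (1 - 1 / (y k - y v)) * c k / (u - y k)) = \<dots>" .
  have "(\<Prod>k\<in>insert v J. 1 - 1 / (u - y k)) = (1 - 1 / (u - y v)) * (1 - (\<Sum>k\<in>J. c k / (u - y k)))"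
    using insert.hyps insert.prems IH by auto
  also have "\<dots> = 1 - ((1 - (\<Sum>k\<in>J. c k / (y v - y k))) / (u - y v) +
      (\<Sum>k\<in>J. (1 - 1 / (y k - y v)) * c k / (u - y k)))"
    unfolding s by (simp add: diff_divide_distrib algebra_simps)
  also have "\<dots> = 1 - (\<Sum>k\<in>insert v J. (\<Prod>i\<in>insert v J - {k}. 1 - 1 / (y k - y i)) / (u - y k))"
    using insert.hyps by (simp add: cv ck cong: sum.cong)
  finally show ?case .
qed simp

text \<open>These are the coefficients of 1/u and 1/u^2 when \<open>partial_fraction_shift\<close>
  is expanded at infinity. The number N(N-1)/2 is distributed over the indices as the count of later
  ones, which is the form in which class ranks appear. A new least index \<open>v\<close> has all of
  \<open>J\<close> after it and leaves the other counts unchanged. The second sum relies on the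
  first.\<close>

lemma sum_shift_weights:
  fixes y :: "'i :: linorder \<Rightarrow> 'a :: field"
  assumes "finite J" "inj_on y J"
  shows "(\<Sum>k\<in>J. \<Prod>i\<in>J - {k}. 1 - 1 / (y k - y i)) = of_nat (card J) \<and>
    (\<Sum>k\<in>J. y k * (\<Prod>i\<in>J - {k}. 1 - 1 / (y k - y i))) = (\<Sum>k\<in>J. y k - of_nat (card {i \<in> J. k < i}))"
  using assms
proof (induction J rule: finite_linorder_min_induct)
  case (insert v J)
  have vJ: "v \<notin> J" using insert.hyps by auto
  define c where "c k = (\<Prod>i\<in>J - {k}. 1 - 1 / (y k - y i))" for k
  have inj: "inj_on y J" and ne: "\<And>k. k \<in> J \<Longrightarrow> y k \<noteq> y v" "y v \<notin> y ` J"
    using insert.prems vJ by (auto simp: inj_on_insert image_iff)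
  have IH: "(\<Sum>k\<in>J. c k) = of_nat (card J)" "(\<Sum>k\<in>J. y k * c k) = (\<Sum>k\<in>J. y k - of_nat (card {i \<in> J. k < i}))"
    using insert.IH[OF inj] by (simp_all add: c_def)
  have ck: "(\<Prod>i\<in>insert v J - {k}. 1 - 1 / (y k - y i)) = (1 - 1 / (y k - y v)) * c k" if "k \<in> J" for k
  proof -
    have "insert v J - {k} = insert v (J - {k})" using that vJ by auto
    then show ?thesis using insert.hyps vJ by (simp add: c_def)
  qed
  have cv: "(\<Prod>i\<in>J. 1 - 1 / (y v - y i)) = 1 - (\<Sum>k\<in>J. c k / (y v - y k))"
    using partial_fraction_shift[OF insert.hyps(1) inj ne(2)] by (simp add: c_def)
  have ex: "(1 - 1 / (y k - y v)) * c k = c k + c k / (y v - y k)" if "k \<in> J" for k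
    using minus_divide_right[of "c k" "y k - y v"] by (simp add: left_diff_distrib)
  have "(\<Sum>k\<in>insert v J. \<Prod>i\<in>insert v J - {k}. 1 - 1 / (y k - y i)) =
      1 - (\<Sum>k\<in>J. c k / (y v - y k)) + (\<Sum>k\<in>J. c k + c k / (y v - y k))"
    using insert.hyps vJ by (simp add: cv ck ex cong: sum.cong)
  also have "\<dots> = 1 + of_nat (card J)"
    by (simp add: sum.distrib IH)
  finally have 1: "(\<Sum>k\<in>insert v J. \<Prod>i\<in>insert v J - {k}. 1 - 1 / (y k - y i)) = of_nat (card (insert v J))"
    using insert.hyps vJ by simp
  \<comment> \<open>Writing \<open>y k\<close> as \<open>y v - (y v - y k)\<close> reproduces the
    sum that \<open>cv\<close> multiplies by \<open>y v\<close>; the two cancel and only minus the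
    sum of the \<open>c k\<close> remains.\<close>
  have ex2: "y k * ((1 - 1 / (y k - y v)) * c k) = y k * c k - c k + y v * (c k / (y v - y k))" if "k \<in> J" for k
  proof -
    have "C = V * D - Y * D \<Longrightarrow> Y * (C + D) = Y * C - C + V * D" for C D Y V :: 'a
      by (simp add: algebra_simps)
    moreover have "c k = y v * (c k / (y v - y k)) - y k * (c k / (y v - y k))"
      using ne(1)[OF that] unfolding left_diff_distrib[symmetric] by simp
    ultimately show ?thesis unfolding ex[OF that] .
  qed
  have "(\<Sum>k\<in>insert v J. y k * (\<Prod>i\<in>insert v J - {k}. 1 - 1 / (y k - y i))) =
      y v * (1 - (\<Sum>k\<in>J. c k / (y v - y k))) + (\<Sum>k\<in>J. y k * c k - c k + y v * (c k / (y v - y k)))"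
    using insert.hyps vJ by (simp add: cv ck ex2 cong: sum.cong)
  also have "\<dots> = (\<Sum>k\<in>J. y k * c k) + y v - (\<Sum>k\<in>J. c k)"
    by (simp add: sum.distrib sum_subtractf sum_distrib_left algebra_simps)
  also have "\<dots> = (\<Sum>k\<in>J. y k - of_nat (card {i \<in> J. k < i})) + y v - of_nat (card J)"
    by (simp add: IH)
  also have "\<dots> = (\<Sum>k\<in>insert v J. y k - of_nat (card {i \<in> insert v J. k < i}))"
  proof -
    have "{i \<in> insert v J. v < i} = J" using insert.hyps by auto
    moreover have "{i \<in> insert v J. k < i} = {i \<in> J. k < i}" if "k \<in> J" for k
      using insert.hyps that by auto
    ultimately show ?thesis using insert.hyps vJ by (simp cong: sum.cong)
  qed
  finally have "(\<Sum>k\<in>insert v J. y k * (\<Prod>i\<in>insert v J - {k}. 1 - 1 / (y k - y i))) =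
      (\<Sum>k\<in>insert v J. y k - of_nat (card {i \<in> insert v J. k < i}))" .
  with 1 show ?case ..
qed simp

section \<open>Residue classes of degree vectors\<close>

lemma jt_cong: "(\<And>j. j < l \<Longrightarrow> n j = n' j) \<Longrightarrow> jt h l n = jt h l n'"
  unfolding jt_def by (intro arg_cong[of _ _ det] eq_matI) auto

lemma pairs_prod_swap: "pairs_prod l f = (\<Prod>i<l. \<Prod>k\<in>{i<..<l}. f i k)"
proof -
  have "pairs_prod l f = (\<Prod>k\<in>{..<l}. \<Prod>i\<in>{i \<in> {..<l}. i < k}. f i k)"
    unfolding pairs_prod_def by (intro prod.cong refl) auto
  also have "\<dots> = (\<Prod>i\<in>{..<l}. \<Prod>k\<in>{k \<in> {..<l}. i < k}. f i k)"
    by (rule prod.swap_restrict) auto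
  also have "\<dots> = (\<Prod>i<l. \<Prod>k\<in>{i<..<l}. f i k)"
    by (intro prod.cong refl) auto
  finally show ?thesis .
qed

lemma multiples_below:
  assumes "p > 0"
  shows "bij_betw (\<lambda>s. a - p * Suc s) {..<a div p} {b. b < a \<and> p dvd a - b}"
proof (rule bij_betw_imageI)
  have le: "p * Suc s \<le> a" if "s < a div p" for s
  proof -
    have "p * Suc s \<le> p * (a div p)" using that by (intro mult_le_mono2) simp
    also have "\<dots> \<le> a" by simp
    finally show ?thesis .
  qed
  show "inj_on (\<lambda>s. a - p * Suc s) {..<a div p}"
  proof (rule inj_onI)
    fix s t assume "s \<in> {..<a div p}" "t \<in> {..<a div p}" "a - p * Suc s = a - p * Suc t"
    then have "p * Suc s = p * Suc t" using le[of s] le[of t] by (metis diff_diff_cancel lessThan_iff)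
    then show "s = t" using assms by simp
  qed
  show "(\<lambda>s. a - p * Suc s) ` {..<a div p} = {b. b < a \<and> p dvd a - b}"
  proof (intro equalityI subsetI)
    fix b assume "b \<in> (\<lambda>s. a - p * Suc s) ` {..<a div p}"
    then obtain s where s: "s < a div p" "b = a - p * Suc s" by auto
    then have "a - b = p * Suc s" using le[of s] by simp
    then show "b \<in> {b. b < a \<and> p dvd a - b}" using assms le[OF s(1)] s by auto
  next
    fix b assume b: "b \<in> {b. b < a \<and> p dvd a - b}"
    then obtain r where r: "a - b = p * r" by blast
    then obtain s where s: "r = Suc s" using b by (cases r) auto
    have "s < a div p"
      using r s b assms by (metis Suc_le_eq diff_le_self div_le_mono nonzero_mult_div_cancel_left not_gr_zero)
    moreover have "b = a - p * Suc s" using r s b by simp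
    ultimately show "b \<in> (\<lambda>s. a - p * Suc s) ` {..<a div p}" by blast
  qed
qed

lemma prod_multiples_below:
  assumes "p > 0"
  shows "(\<Prod>b | b < a \<and> p dvd a - b. real (a - b)) = real p ^ (a div p) * fact (a div p)"
proof -
  have "(\<Prod>b | b < a \<and> p dvd a - b. real (a - b)) = (\<Prod>s<a div p. real (a - (a - p * Suc s)))"
    using multiples_below[OF assms, of a] by (rule prod.reindex_bij_betw[symmetric])
  also have "\<dots> = (\<Prod>s<a div p. real p * real (Suc s))"
  proof (rule prod.cong[OF refl])
    fix s assume "s \<in> {..<a div p}"
    then have "p * Suc s \<le> p * (a div p)" by (intro mult_le_mono2) simp
    also have "\<dots> \<le> a" by simp
    finally show "real (a - (a - p * Suc s)) = real p * real (Suc s)" by (simp only: diff_diff_cancel of_nat_mult)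
  qed
  also have "\<dots> = real p ^ (a div p) * fact (a div p)"
    unfolding prod.distrib by (simp add: fact_prod_Suc lessThan_atLeast0)
  finally show ?thesis .
qed

text \<open>Degree vectors are not re-sorted when a bead moves from \<open>a\<close> to \<open>a - p\<close>: only the order inside each
  residue class modulo \<open>p\<close> matters, and it is preserved. \<open>class_core\<close> is the vector in which every
  residue class is pushed down completely, and \<open>class_weight\<close> is the number of moves to get there.\<close>

definition class_decreasing :: "nat \<Rightarrow> nat \<Rightarrow> (nat \<Rightarrow> nat) \<Rightarrow> bool" where
  "class_decreasing p l n \<longleftrightarrow> (\<forall>i j. i < j \<longrightarrow> j < l \<longrightarrow> n i mod p = n j mod p \<longrightarrow> n j < n i)"

text \<open>In a class-decreasing vector the later entries of a class are the smaller ones, so this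
  is the level at which entry \<open>j\<close> ends once its class is pushed down.\<close>

definition class_rank :: "nat \<Rightarrow> nat \<Rightarrow> (nat \<Rightarrow> nat) \<Rightarrow> nat \<Rightarrow> nat" where
  "class_rank p l n j = card {k. j < k \<and> k < l \<and> n k mod p = n j mod p}"

definition class_core :: "nat \<Rightarrow> nat \<Rightarrow> (nat \<Rightarrow> nat) \<Rightarrow> nat \<Rightarrow> nat" where
  "class_core p l n j = p * class_rank p l n j + n j mod p"

definition class_weight :: "nat \<Rightarrow> nat \<Rightarrow> (nat \<Rightarrow> nat) \<Rightarrow> nat" where
  "class_weight p l n = (\<Sum>j<l. n j div p - class_rank p l n j)"

text \<open>The inverse of the product of the hook lengths divisible by \<open>p\<close>, as
  \<open>class_vdm_legs\<close> shows. The formula with differences also makes sense for repeated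
  entries and is 0 there, just like the determinant, so forbidden moves need no separate treatment
  in sums.\<close>

definition class_vdm :: "nat \<Rightarrow> nat \<Rightarrow> (nat \<Rightarrow> nat) \<Rightarrow> real" where
  "class_vdm p l n =
     pairs_prod l (\<lambda>i k. if n i mod p = n k mod p then real (n i) - real (n k) else 1) /
     (\<Prod>j<l. real p ^ (n j div p) * fact (n j div p))"

lemma class_decreasing_inj:
  assumes "class_decreasing p l n"
  shows "inj_on n {..<l}"
proof (rule inj_onI)
  fix i j assume "i \<in> {..<l}" "j \<in> {..<l}" "n i = n j"
  then show "i = j"
    using assms unfolding class_decreasing_def
    by (metis lessThan_iff linorder_neqE_nat order_less_irrefl)
qed

text \<open>The gaps of \<open>B\<close> below \<open>a\<close> on the same runner. When
  \<open>B\<close> is the set of beta numbers, the differences \<open>a - b\<close> are the hook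
  lengths divisible by \<open>p\<close> in the row of \<open>a\<close>.\<close>

definition pfold_legs :: "nat \<Rightarrow> nat set \<Rightarrow> nat \<Rightarrow> nat set" where
  "pfold_legs p B a = {b. b < a \<and> b \<notin> B \<and> p dvd a - b}"

lemma multiples_below_split:
  assumes cd: "class_decreasing p l n" and j: "j < l"
  defines "K \<equiv> {k. j < k \<and> k < l \<and> n k mod p = n j mod p}"
  shows "{b. b < n j \<and> p dvd n j - b} = pfold_legs p (n ` {..<l}) (n j) \<union> n ` K"
    and "pfold_legs p (n ` {..<l}) (n j) \<inter> n ` K = {}"
    and "inj_on n K" and "finite K"
proof -
  have dec: "n b < n a" if "a < b" "b < l" "n a mod p = n b mod p" for a b
    using cd that unfolding class_decreasing_def by blast
  have dvd: "p dvd n j - n k \<longleftrightarrow> n j mod p = n k mod p" if "n k < n j" for k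
    using mod_eq_dvd_iff_nat[of "n k" "n j" p] that by simp
  have iff: "n k < n j \<and> p dvd n j - n k \<longleftrightarrow> k \<in> K" if "k < l" for k
  proof
    assume a: "n k < n j \<and> p dvd n j - n k"
    then have m: "n k mod p = n j mod p" using dvd[of k] by simp
    have "\<not> k < j" using dec[of k j] a m j by auto
    moreover have "k \<noteq> j" using a by auto
    ultimately show "k \<in> K" using that m by (simp add: K_def)
  next
    assume "k \<in> K"
    then have k: "j < k" "k < l" "n k mod p = n j mod p" by (auto simp: K_def)
    then have "n k < n j" using dec[of j k] by simp
    then show "n k < n j \<and> p dvd n j - n k" using k(3) dvd[of k] by simp
  qed
  show "{b. b < n j \<and> p dvd n j - b} = pfold_legs p (n ` {..<l}) (n j) \<union> n ` K"
  proof (intro equalityI subsetI)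
    fix b assume b: "b \<in> {b. b < n j \<and> p dvd n j - b}"
    show "b \<in> pfold_legs p (n ` {..<l}) (n j) \<union> n ` K"
    proof (cases "b \<in> n ` {..<l}")
      case True
      then show ?thesis using b iff by auto
    next
      case False
      then show ?thesis using b by (auto simp: pfold_legs_def)
    qed
  next
    fix b assume "b \<in> pfold_legs p (n ` {..<l}) (n j) \<union> n ` K"
    then show "b \<in> {b. b < n j \<and> p dvd n j - b}"
    proof
      assume "b \<in> n ` K"
      then obtain k where "k \<in> K" "b = n k" by auto
      moreover have "k < l" using \<open>k \<in> K\<close> by (simp add: K_def)
      ultimately show ?thesis using iff by auto
    qed (auto simp: pfold_legs_def)
  qed
  show "pfold_legs p (n ` {..<l}) (n j) \<inter> n ` K = {}" by (auto simp: pfold_legs_def K_def)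
  show "inj_on n K" by (rule inj_on_subset[OF class_decreasing_inj[OF cd]]) (auto simp: K_def)
  show "finite K" by (simp add: K_def)
qed

lemma finite_pfold_legs: "finite (pfold_legs p B a)"
  by (rule finite_subset[of _ "{..<a}"]) (auto simp: pfold_legs_def)

text \<open>Below \<open>n j\<close> its runner has \<open>n j div p\<close> positions, each a gap
  or a later entry of the class. In particular the truncated differences in
  \<open>class_weight\<close> are exact and count gaps.\<close>

lemma card_pfold_legs:
  assumes "p > 0" "class_decreasing p l n" "j < l"
  shows "card (pfold_legs p (n ` {..<l}) (n j)) + class_rank p l n j = n j div p"
proof -
  note s = multiples_below_split[OF assms(2,3)]
  have "n j div p = card {b. b < n j \<and> p dvd n j - b}"
    using bij_betw_same_card[OF multiples_below[OF assms(1), of "n j"]] by simp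
  also have "\<dots> = card (pfold_legs p (n ` {..<l}) (n j)) + class_rank p l n j"
    unfolding s(1) class_rank_def card_image[OF s(3), symmetric]
    using s(2,4) finite_pfold_legs by (intro card_Un_disjoint) auto
  finally show ?thesis ..
qed

text \<open>\<open>p ^ y * fact y\<close> with \<open>y = n j div p\<close> is the product of the
  distances from \<open>n j\<close> to all lower positions of its runner. The occupied positions
  cancel against the Vandermonde factors and the gaps remain.\<close>

lemma class_vdm_legs:
  assumes "p > 0" "class_decreasing p l n"
  shows "class_vdm p l n * (\<Prod>j<l. \<Prod>b\<in>pfold_legs p (n ` {..<l}) (n j). real (n j - b)) = 1"
proof -
  let ?K = "\<lambda>j. {k. j < k \<and> k < l \<and> n k mod p = n j mod p}"
  have "(\<Prod>j<l. real p ^ (n j div p) * fact (n j div p)) =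
      (\<Prod>j<l. \<Prod>b | b < n j \<and> p dvd n j - b. real (n j - b))"
    by (simp only: prod_multiples_below[OF assms(1)])
  also have "\<dots> = (\<Prod>j<l. (\<Prod>b\<in>pfold_legs p (n ` {..<l}) (n j). real (n j - b)) *
      (\<Prod>k\<in>?K j. real (n j) - real (n k)))"
  proof (rule prod.cong[OF refl])
    fix j assume "j \<in> {..<l}"
    then have j: "j < l" by simp
    note s = multiples_below_split[OF assms(2) j]
    have "(\<Prod>k\<in>?K j. real (n j - n k)) = (\<Prod>k\<in>?K j. real (n j) - real (n k))"
    proof (rule prod.cong[OF refl])
      fix k assume "k \<in> ?K j"
      then have "n k < n j" using assms(2) unfolding class_decreasing_def by simp
      then show "real (n j - n k) = real (n j) - real (n k)" by simp
    qed
    then show "(\<Prod>b | b < n j \<and> p dvd n j - b. real (n j - b)) =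
        (\<Prod>b\<in>pfold_legs p (n ` {..<l}) (n j). real (n j - b)) * (\<Prod>k\<in>?K j. real (n j) - real (n k))"
      unfolding s(1) using s(2,4) finite_pfold_legs
      by (subst prod.union_disjoint) (auto simp: prod.reindex[OF s(3)])
  qed
  also have "\<dots> = (\<Prod>j<l. \<Prod>b\<in>pfold_legs p (n ` {..<l}) (n j). real (n j - b)) *
      (\<Prod>j<l. \<Prod>k\<in>?K j. real (n j) - real (n k))"
    by (rule prod.distrib)
  also have "(\<Prod>j<l. \<Prod>k\<in>?K j. real (n j) - real (n k)) =
      pairs_prod l (\<lambda>i k. if n i mod p = n k mod p then real (n i) - real (n k) else 1)"
    unfolding pairs_prod_swap
  proof (rule prod.cong[OF refl])
    fix j assume "j \<in> {..<l}"
    have "?K j = {k \<in> {j<..<l}. n j mod p = n k mod p}" by auto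
    then show "(\<Prod>k\<in>?K j. real (n j) - real (n k)) =
        (\<Prod>k\<in>{j<..<l}. if n j mod p = n k mod p then real (n j) - real (n k) else 1)"
      by (simp only: prod.inter_filter finite_greaterThanLessThan)
  qed
  finally have "(\<Prod>j<l. real p ^ (n j div p) * fact (n j div p)) =
      (\<Prod>j<l. \<Prod>b\<in>pfold_legs p (n ` {..<l}) (n j). real (n j - b)) *
      pairs_prod l (\<lambda>i k. if n i mod p = n k mod p then real (n i) - real (n k) else 1)" .
  moreover have "(\<Prod>j<l. real p ^ (n j div p) * fact (n j div p)) \<noteq> 0" using assms(1) by simp
  ultimately show ?thesis unfolding class_vdm_def by (simp add: field_simps)
qed

lemma class_vdm_repeated:
  assumes "a < b" "b < l" "n a = n b"
  shows "class_vdm p l n = 0"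
  unfolding class_vdm_def using assms by (subst pairs_prod_zero[of a b]) auto

text \<open>A difference \<open>p * x\<close> through \<open>j\<close> becomes
  \<open>p * x - p = p * x * (1 - 1 / x)\<close>, and the denominator loses the factor
  \<open>p * (n j div p)\<close>. If \<open>n j - p\<close> is occupied, the factor with
  \<open>x = 1\<close> makes both sides 0.\<close>

lemma class_vdm_slide:
  assumes p: "p > 0" and cd: "class_decreasing p l n" and j: "j < l" and pn: "p \<le> n j"
  shows "class_vdm p l (n(j := n j - p)) = real p * class_vdm p l n *
    (real (n j div p) * (\<Prod>k\<in>{k \<in> {..<l}. n k mod p = n j mod p} - {j}. 1 - 1 / (real (n j div p) - real (n k div p))))"
proof -
  define n' where "n' = n(j := n j - p)"
  define f where "f i k = (if n i mod p = n k mod p then real (n i) - real (n k) else 1)" for i k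
  define r where "r k = (if n k mod p = n j mod p then 1 - 1 / (real (n j div p) - real (n k div p)) else 1)" for k
  have res: "n' i mod p = n i mod p" for i using pn by (simp add: n'_def mod_if[of "n j"])
  have diff: "real (n i) - real (n k) = real p * (real (n i div p) - real (n k div p))"
    if "n i mod p = n k mod p" for i k
  proof -
    have "real (n i) = real p * real (n i div p) + real (n i mod p)" for i
      by (metis mult_div_mod_eq of_nat_add of_nat_mult)
    then show ?thesis using that by (simp add: algebra_simps)
  qed
  have ne: "real (n i div p) - real (n k div p) \<noteq> 0" if "n i mod p = n k mod p" "i < l" "k < l" "i \<noteq> k" for i k
  proof -
    have "n i \<noteq> n k" using class_decreasing_inj[OF cd] that by (auto dest: inj_onD)
    then have "n i div p \<noteq> n k div p" using that(1) by (metis mult_div_mod_eq)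
    then show ?thesis by simp
  qed
  have shift: "real p * x - real p = real p * x * (1 - 1 / x)" if "x \<noteq> 0" for x :: real
    using that by (simp add: field_simps)
  have "pairs_prod l (\<lambda>i k. if n' i mod p = n' k mod p then real (n' i) - real (n' k) else 1) =
      pairs_prod l (\<lambda>i k. f i k * (if i = j then r k else if k = j then r i else 1))"
  proof (rule pairs_prod_cong)
    fix i k :: nat assume ik: "i < k" "k < l"
    consider "n i mod p \<noteq> n k mod p" | "n i mod p = n k mod p" "i = j" | "n i mod p = n k mod p" "k = j" 
      | "i \<noteq> j" "k \<noteq> j" by blast
    then show "(if n' i mod p = n' k mod p then real (n' i) - real (n' k) else 1) =
        f i k * (if i = j then r k else if k = j then r i else 1)"
    proof cases
      case 1
      then show ?thesis unfolding res f_def r_def by auto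
    next
      case 2
      then have "real (n' i) - real (n' k) = real (n j) - real (n k) - real p"
        using ik pn by (simp add: n'_def)
      also have "\<dots> = (real (n j) - real (n k)) * r k"
        using 2 ik diff[of j k] ne[of j k] shift by (simp add: r_def)
      finally show ?thesis using 2 ik unfolding res f_def by simp
    next
      case 3
      have "real (n' i) - real (n' k) = - (real (n j) - real (n i) - real p)"
        using 3 ik pn by (simp add: n'_def)
      also have "real (n j) - real (n i) - real p = (real (n j) - real (n i)) * r i"
        using 3 ik diff[of j i] ne[of j i] shift by (simp add: r_def)
      finally show ?thesis using 3 ik unfolding res f_def by (simp add: algebra_simps)
    next
      case 4
      then show ?thesis unfolding res f_def by (simp add: n'_def)
    qed
  qed
  also have "\<dots> = pairs_prod l f * (\<Prod>k\<in>{..<l} - {j}. r k)"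
    unfolding pairs_prod_mult pairs_prod_through[OF j] ..
  also have "(\<Prod>k\<in>{..<l} - {j}. r k) =
      (\<Prod>k\<in>{k \<in> {..<l}. n k mod p = n j mod p} - {j}. 1 - 1 / (real (n j div p) - real (n k div p)))"
    by (rule prod.mono_neutral_cong_right) (auto simp: r_def)
  finally have num: "pairs_prod l (\<lambda>i k. if n' i mod p = n' k mod p then real (n' i) - real (n' k) else 1) =
      pairs_prod l f * \<dots>" .
  obtain y where y: "n j div p = Suc y"
    using pn p by (cases "n j div p") (auto simp: div_eq_0_iff)
  have yy: "(n j - p) div p = y" using y pn p by (simp add: le_div_geq)
  define D where "D = (\<Prod>i\<in>{..<l} - {j}. real p ^ (n i div p) * fact (n i div p))"
  have D: "D \<noteq> 0" using p by (simp add: D_def)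
  have d1: "(\<Prod>i<l. real p ^ (n i div p) * fact (n i div p)) = (real p ^ Suc y * fact (Suc y)) * D"
    using j y by (subst prod.remove[of _ j]) (auto simp: D_def)
  have "(\<Prod>i\<in>{..<l} - {j}. real p ^ (n' i div p) * fact (n' i div p)) = D"
    unfolding D_def by (rule prod.cong) (auto simp: n'_def)
  then have d2: "(\<Prod>i<l. real p ^ (n' i div p) * fact (n' i div p)) = (real p ^ y * fact y) * D"
    using j yy by (subst prod.remove[of _ j]) (auto simp: n'_def)
  show ?thesis
    unfolding class_vdm_def n'_def[symmetric] num d1 d2 f_def[symmetric] y using p D
    by (simp add: field_simps del: of_nat_Suc)
qed

text \<open>The branching rule of the hook length formula: dividing out
  \<open>class_vdm p l n\<close>, the moves within one residue class contribute the weighted sum of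
  \<open>sum_shift_weights\<close>, which evaluates to the number of moves this class still
  allows.\<close>

lemma class_vdm_branching:
  assumes p: "p > 0" and cd: "class_decreasing p l n"
  shows "(\<Sum>j<l. if p \<le> n j then class_vdm p l (n(j := n j - p)) else 0) =
    real p * real (class_weight p l n) * class_vdm p l n"
proof -
  define J where "J c = {k \<in> {..<l}. n k mod p = c}" for c
  define y where "y k = real (n k div p)" for k
  define g where "g j = y j * (\<Prod>k\<in>J (n j mod p) - {j}. 1 - 1 / (y j - y k))" for j
  \<comment> \<open>For \<open>n j < p\<close> the quotient \<open>y j\<close> is 0, so
    \<open>g j = 0\<close> and the case distinction disappears.\<close>
  have "(\<Sum>j<l. if p \<le> n j then class_vdm p l (n(j := n j - p)) else 0) =
      (\<Sum>j<l. real p * class_vdm p l n * g j)"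
  proof (rule sum.cong[OF refl])
    fix j assume "j \<in> {..<l}"
    then show "(if p \<le> n j then class_vdm p l (n(j := n j - p)) else 0) = real p * class_vdm p l n * g j"
      using class_vdm_slide[OF p cd, of j] by (auto simp: g_def y_def J_def)
  qed
  also have "\<dots> = real p * class_vdm p l n * (\<Sum>j<l. g j)"
    by (rule sum_distrib_left[symmetric])
  also have "(\<Sum>j<l. g j) = (\<Sum>c<p. \<Sum>j\<in>J c. g j)"
    unfolding J_def using p by (intro sum.group[symmetric]) auto
  also have "\<dots> = (\<Sum>c<p. \<Sum>j\<in>J c. y j - real (class_rank p l n j))"
  proof (rule sum.cong[OF refl])
    fix c assume "c \<in> {..<p}"
    have inj: "inj_on y (J c)"
    proof (rule inj_onI)
      fix a b assume ab: "a \<in> J c" "b \<in> J c" "y a = y b"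
      then have "n a div p = n b div p" "n a mod p = n b mod p" by (simp_all add: J_def y_def)
      then have "n a = n b" by (metis mult_div_mod_eq)
      then show "a = b" using class_decreasing_inj[OF cd] ab by (auto simp: J_def dest: inj_onD)
    qed
    have "(\<Sum>j\<in>J c. g j) = (\<Sum>j\<in>J c. y j * (\<Prod>k\<in>J c - {j}. 1 - 1 / (y j - y k)))"
      by (intro sum.cong refl) (simp add: g_def J_def)
    also have "\<dots> = (\<Sum>j\<in>J c. y j - real (card {i \<in> J c. j < i}))"
      using sum_shift_weights[OF _ inj] by (simp add: J_def)
    also have "\<dots> = (\<Sum>j\<in>J c. y j - real (class_rank p l n j))"
      unfolding class_rank_def
      by (intro sum.cong refl arg_cong[of _ _ "\<lambda>A. y _ - real (card A)"]) (auto simp: J_def)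
    finally show "(\<Sum>j\<in>J c. g j) = (\<Sum>j\<in>J c. y j - real (class_rank p l n j))" .
  qed
  also have "\<dots> = (\<Sum>j<l. y j - real (class_rank p l n j))"
    unfolding J_def using p by (intro sum.group) auto
  also have "\<dots> = real (class_weight p l n)"
    unfolding class_weight_def of_nat_sum
  proof (rule sum.cong[OF refl])
    fix j assume "j \<in> {..<l}"
    then show "y j - real (class_rank p l n j) = real (n j div p - class_rank p l n j)"
      using card_pfold_legs[OF p cd, of j] by (simp add: y_def)
  qed
  finally show ?thesis by simp
qed

section \<open>Coefficients of the determinants\<close>

text \<open>Rank and core depend only on the residues and the positions of the entries, and a slide
  keeps both.\<close>

lemma class_core_slide:
  assumes "p \<le> n j"
  shows "class_core p l (n(j := n j - p)) = class_core p l n"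
    and "class_rank p l (n(j := n j - p)) = class_rank p l n"
proof -
  have res: "(n(j := n j - p)) i mod p = n i mod p" for i using assms by (simp add: mod_if[of "n j"])
  show "class_rank p l (n(j := n j - p)) = class_rank p l n"
    by (rule ext) (simp only: class_rank_def res)
  then show "class_core p l (n(j := n j - p)) = class_core p l n"
    by (intro ext) (simp only: class_core_def res)
qed

text \<open>The smaller entries of the class lie at least \<open>p\<close> below \<open>n j\<close>,
  so the only possible conflict is an entry equal to \<open>n j - p\<close>.\<close>

lemma class_decreasing_slide:
  assumes p: "p > 0" and cd: "class_decreasing p l n" and pn: "p \<le> n j"
    and new: "\<And>k. k < l \<Longrightarrow> n k \<noteq> n j - p"
  shows "class_decreasing p l (n(j := n j - p))"
  unfolding class_decreasing_def
proof (intro allI impI)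
  let ?n' = "n(j := n j - p)"
  fix a b assume ab: "a < b" "b < l" "?n' a mod p = ?n' b mod p"
  have res: "?n' i mod p = n i mod p" for i using pn by (simp add: mod_if[of "n j"])
  have lt: "n b < n a" using cd ab unfolding class_decreasing_def res by blast
  show "?n' b < ?n' a"
  proof (cases "a = j")
    case True
    have "p dvd n j - n b"
      using lt True ab(3) mod_eq_dvd_iff_nat[of "n b" "n j" p] unfolding res by simp
    then have "p \<le> n j - n b" using lt True by (intro dvd_imp_le) auto
    then have "n b \<le> n j - p" using pn p by linarith
    moreover have "n b \<noteq> n j - p" using new[of b] ab by simp
    ultimately show ?thesis using True ab by simp
  next
    case False
    then show ?thesis using lt by auto
  qed
qed

text \<open>The order is assumed of the new vector, because the rank must not exceed the lowered
  quotient if the truncated difference is to drop by exactly 1.\<close>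

lemma class_weight_slide:
  assumes p: "p > 0" and cd: "class_decreasing p l (n(j := n j - p))" and j: "j < l" and pn: "p \<le> n j"
  shows "class_weight p l n = Suc (class_weight p l (n(j := n j - p)))"
proof -
  let ?n' = "n(j := n j - p)"
  have e: "n j div p = Suc (?n' j div p)" using pn p by (simp add: le_div_geq)
  have le: "class_rank p l n j \<le> ?n' j div p"
    using card_pfold_legs[OF p cd j] class_core_slide(2)[of p n j l, OF pn] by simp
  have "class_weight p l n = (n j div p - class_rank p l n j) + (\<Sum>i\<in>{..<l} - {j}. n i div p - class_rank p l n i)"
    unfolding class_weight_def using j by (intro sum.remove) auto
  also have "\<dots> = Suc ((?n' j div p - class_rank p l n j) + (\<Sum>i\<in>{..<l} - {j}. ?n' i div p - class_rank p l n i))"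
    using le unfolding e by (simp add: Suc_diff_le)
  also have "(?n' j div p - class_rank p l n j) + (\<Sum>i\<in>{..<l} - {j}. ?n' i div p - class_rank p l n i) =
      class_weight p l ?n'"
    unfolding class_weight_def class_core_slide(2)[of p n j l, OF pn] using j by (intro sum.remove[symmetric]) auto
  finally show ?thesis .
qed

lemma class_weight_total:
  assumes p: "p > 0" and cd: "class_decreasing p l n"
  shows "(\<Sum>j<l. n j) = (\<Sum>j<l. class_core p l n j) + p * class_weight p l n"
proof -
  have "n j = class_core p l n j + p * (n j div p - class_rank p l n j)" if "j < l" for j
  proof -
    have "class_rank p l n j \<le> n j div p" using card_pfold_legs[OF p cd that] by simp
    then have "p * (n j div p - class_rank p l n j) + p * class_rank p l n j = p * (n j div p)"
      unfolding distrib_left[symmetric] by simp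
    then show ?thesis using mult_div_mod_eq[of p "n j"] unfolding class_core_def by linarith
  qed
  then have "(\<Sum>j<l. n j) = (\<Sum>j<l. class_core p l n j + p * (n j div p - class_rank p l n j))"
    by (intro sum.cong) auto
  then show ?thesis by (simp add: sum.distrib class_weight_def sum_distrib_left)
qed

lemma class_weight_eq_0:
  assumes p: "p > 0" and cd: "class_decreasing p l n" and w: "class_weight p l n = 0" and j: "j < l"
  shows "n j = class_core p l n j" "pfold_legs p (n ` {..<l}) (n j) = {}"
proof -
  have "n j div p - class_rank p l n j = 0" using w j unfolding class_weight_def by simp
  then have e: "card (pfold_legs p (n ` {..<l}) (n j)) = 0" "n j div p = class_rank p l n j"
    using card_pfold_legs[OF p cd j] by simp_all
  show "pfold_legs p (n ` {..<l}) (n j) = {}" using e(1) finite_pfold_legs by auto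
  show "n j = class_core p l n j" unfolding class_core_def e(2)[symmetric] by simp
qed

text \<open>Induction on the number of moves. At \<kappa> the left factor of the recursion is
  \<open>p * class_weight p l n\<close>, exactly the factor that \<open>class_vdm_branching\<close>
  produces on the right, so it cancels, and each level contributes one minus sign.\<close>

lemma jt_hpoly_lowest:
  assumes p: "p > 0" and "class_decreasing p l n"
    and "int \<kappa> = (\<Sum>j<l. int (class_core p l n j) - int j)"
  defines "S \<equiv> \<lambda>n. jt (hpoly p) l (\<lambda>j. int (n j))"
  shows "(\<forall>k. coeff (S n) k \<noteq> 0 \<longrightarrow> (\<exists>s\<le>class_weight p l n. k = \<kappa> + p * s)) \<and>
    coeff (S n) \<kappa> = coeff (S (class_core p l n)) \<kappa> * (-1) ^ class_weight p l n * class_vdm p l n"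
  using assms(2,3)
proof (induction "class_weight p l n" arbitrary: n rule: less_induct)
  case less
  let ?W = "class_weight p l n"
  let ?n = "\<lambda>j. n(j := n j - p)"
  note cd = less.prems(1)
  have tot: "(\<Sum>j<l. int (n j) - int j) = int (\<kappa> + p * ?W)"
    using class_weight_total[OF p cd] less.prems(2) by (simp add: sum_subtractf flip: of_nat_sum)
  have rec: "(real (\<kappa> + p * ?W) - real k) * coeff (S n) k =
      - (\<Sum>j<l. if p \<le> n j then coeff (S (?n j)) k else 0)" for k
  proof -
    have "coeff (jt (hpoly p) l ((\<lambda>j. int (n j))(j := int (n j) - int p))) k =
        (if p \<le> n j then coeff (S (?n j)) k else 0)" if "j < l" for j
    proof (cases "p \<le> n j")
      case True
      then have "(\<lambda>j. int (n j))(j := int (n j) - int p) = (\<lambda>i. int (?n j i))" by auto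
      then show ?thesis using True by (simp add: S_def)
    next
      case False
      then have "jt (hpoly p) l ((\<lambda>j. int (n j))(j := int (n j) - int p)) = 0"
        using that by (intro jt_eq_0_negative[of j]) (auto simp: hpoly_def)
      then show ?thesis using False by simp
    qed
    then have sums: "(\<Sum>j<l. coeff (jt (hpoly p) l ((\<lambda>j. int (n j))(j := int (n j) - int p))) k) =
        (\<Sum>j<l. if p \<le> n j then coeff (S (?n j)) k else 0)"
      by (intro sum.cong) auto
    show ?thesis
      using jt_hpoly_recurrence[OF p, of "\<lambda>j. int (n j)" l k]
      unfolding tot sums of_int_of_nat_eq by (simp only: S_def)
  qed
  \<comment> \<open>If the target is occupied, two entries agree and both determinant and
    \<open>class_vdm\<close> are 0; otherwise the weight drops by 1. Hence the truncated
    \<open>?W - 1\<close> does no harm at weight 0.\<close>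
  have slide: "(\<forall>k. coeff (S (?n j)) k \<noteq> 0 \<longrightarrow> (\<exists>s<?W. k = \<kappa> + p * s)) \<and>
      coeff (S (?n j)) \<kappa> = coeff (S (class_core p l n)) \<kappa> * (-1) ^ (?W - 1) * class_vdm p l (?n j)"
    if j: "j < l" and pn: "p \<le> n j" for j
  proof (cases "\<exists>k<l. n k = n j - p")
    case True
    then obtain k where k: "k < l" "n k = n j - p" by blast
    then have kj: "k \<noteq> j" using p pn by auto
    obtain a b where ab: "a < b" "b < l" "?n j a = ?n j b"
    proof (cases "k < j")
      case True
      then show ?thesis using k kj j that[of k j] by simp
    next
      case False
      then show ?thesis using k kj j that[of j k] by simp
    qed
    have "S (?n j) = 0" unfolding S_def using ab by (intro jt_eq_0_repeated[of a b]) auto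
    moreover have "class_vdm p l (?n j) = 0" by (rule class_vdm_repeated[OF ab])
    ultimately show ?thesis by simp
  next
    case False
    then have cd': "class_decreasing p l (?n j)" by (intro class_decreasing_slide[OF p cd pn]) auto
    have w: "?W = Suc (class_weight p l (?n j))" by (rule class_weight_slide[OF p cd' j pn])
    have "(\<forall>k. coeff (S (?n j)) k \<noteq> 0 \<longrightarrow> (\<exists>s\<le>class_weight p l (?n j). k = \<kappa> + p * s)) \<and>
        coeff (S (?n j)) \<kappa> = coeff (S (class_core p l (?n j))) \<kappa> *
          (-1) ^ class_weight p l (?n j) * class_vdm p l (?n j)"
      using less.prems(2) w by (intro less.hyps cd') (simp_all add: class_core_slide(1)[of p n j l, OF pn])
    then show ?thesis unfolding class_core_slide(1)[of p n j l, OF pn] w by (auto simp: less_Suc_eq_le)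
  qed
  \<comment> \<open>Away from the top exponent the left factor is nonzero, so an exponent of
    \<open>S n\<close> must already occur after one of the moves.\<close>
  have supp: "\<exists>s\<le>?W. k = \<kappa> + p * s" if k: "coeff (S n) k \<noteq> 0" for k
  proof (cases "k = \<kappa> + p * ?W")
    case False
    then have "(real (\<kappa> + p * ?W) - real k) * coeff (S n) k \<noteq> 0" using k by (simp del: of_nat_add of_nat_mult)
    then have "(\<Sum>j<l. if p \<le> n j then coeff (S (?n j)) k else 0) \<noteq> 0" unfolding rec by simp
    then obtain j where "j \<in> {..<l}" "(if p \<le> n j then coeff (S (?n j)) k else 0) \<noteq> 0"
      by (rule sum.not_neutral_contains_not_neutral)
    then have "j < l" "p \<le> n j" "coeff (S (?n j)) k \<noteq> 0" by (auto split: if_splits)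
    then show ?thesis using slide[of j] by (meson less_imp_le)
  qed blast
  have low: "coeff (S n) \<kappa> = coeff (S (class_core p l n)) \<kappa> * (-1) ^ ?W * class_vdm p l n"
  proof (cases "?W = 0")
    \<comment> \<open>The recursion reads 0 = 0 here. Instead, \<open>n\<close> is its own class
      core, and \<open>class_vdm\<close> is 1 because there are no gaps.\<close>
    case True
    have "S n = S (class_core p l n)"
      unfolding S_def using class_weight_eq_0(1)[OF p cd True] by (intro jt_cong) auto
    moreover have "(\<Prod>j<l. \<Prod>b\<in>pfold_legs p (n ` {..<l}) (n j). real (n j - b)) = 1"
      using class_weight_eq_0(2)[OF p cd True] by simp
    then have "class_vdm p l n = 1" using class_vdm_legs[OF p cd] by simp
    ultimately show ?thesis using True by simp
  next
    case False
    then obtain w where w: "?W = Suc w" by (cases ?W) auto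
    let ?C = "coeff (S (class_core p l n)) \<kappa>"
    have "real p * real ?W * coeff (S n) \<kappa> = - (\<Sum>j<l. if p \<le> n j then coeff (S (?n j)) \<kappa> else 0)"
      using rec[of \<kappa>] by simp
    also have "(\<Sum>j<l. if p \<le> n j then coeff (S (?n j)) \<kappa> else 0) =
        (\<Sum>j<l. ?C * (-1) ^ w * (if p \<le> n j then class_vdm p l (?n j) else 0))"
    proof (rule sum.cong[OF refl])
      fix j assume "j \<in> {..<l}"
      then show "(if p \<le> n j then coeff (S (?n j)) \<kappa> else 0) =
          ?C * (-1) ^ w * (if p \<le> n j then class_vdm p l (?n j) else 0)"
        using slide[of j, THEN conjunct2] by (simp add: w)
    qed
    also have "\<dots> = ?C * (-1) ^ w * (real p * real ?W * class_vdm p l n)"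
      unfolding class_vdm_branching[OF p cd, symmetric] by (rule sum_distrib_left[symmetric])
    finally have "real p * real ?W * coeff (S n) \<kappa> = real p * real ?W * (?C * (-1) ^ ?W * class_vdm p l n)"
      unfolding w by (simp add: algebra_simps del: of_nat_Suc)
    then show ?thesis using p False by simp
  qed
  from supp low show ?case by blast
qed

section \<open>Vandermonde products: gaps and signs\<close>

lemma abs_vdm_hooks:
  assumes inj: "inj_on n {..<l}"
  shows "\<bar>vdm l n\<bar> * (\<Prod>j<l. \<Prod>b\<in>{..<n j} - n ` {..<l}. real (n j - b)) = (\<Prod>j<l. fact (n j))"
proof -
  \<comment> \<open>Exactly one of \<open>F i k\<close> and \<open>F k i\<close> is the distance of
    the two entries, the other is 1; this allows regrouping the pairs by their larger entry.\<close>
  define F where "F j k = (if n k < n j then real (n j - n k) else 1)" for j k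
  have "\<bar>vdm l n\<bar> = pairs_prod l (\<lambda>i k. F i k * F k i)"
    unfolding vdm_def pairs_prod_def abs_prod F_def
  proof (intro prod.cong refl)
    fix k i assume "k \<in> {..<l}" "i \<in> {..<k}"
    then have "n i \<noteq> n k" using inj_onD[OF inj, of i k] by auto
    then show "\<bar>real (n k) - real (n i)\<bar> =
        (if n k < n i then real (n i - n k) else 1) * (if n i < n k then real (n k - n i) else 1)" by auto
  qed
  also have "\<dots> = (\<Prod>j<l. (\<Prod>k\<in>{j<..<l}. F j k) * (\<Prod>k<j. F j k))"
    unfolding pairs_prod_mult prod.distrib pairs_prod_swap[of l F] by (simp add: pairs_prod_def)
  also have "\<dots> = (\<Prod>j<l. \<Prod>k\<in>{k \<in> {..<l}. n k < n j}. real (n j - n k))"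
  proof (rule prod.cong[OF refl])
    fix j assume "j \<in> {..<l}"
    then have split: "{..<l} = insert j ({j<..<l} \<union> {..<j})" by auto
    have "(\<Prod>k\<in>{j<..<l} \<union> {..<j}. F j k) = (\<Prod>k\<in>{j<..<l}. F j k) * (\<Prod>k<j. F j k)"
      by (rule prod.union_disjoint) auto
    then have "(\<Prod>k<l. F j k) = F j j * ((\<Prod>k\<in>{j<..<l}. F j k) * (\<Prod>k<j. F j k))"
      unfolding split by (subst prod.insert) auto
    moreover have "(\<Prod>k<l. F j k) = (\<Prod>k\<in>{k \<in> {..<l}. n k < n j}. real (n j - n k))"
      unfolding F_def by (rule prod.inter_filter[symmetric]) simp
    ultimately show "(\<Prod>k\<in>{j<..<l}. F j k) * (\<Prod>k<j. F j k) =
        (\<Prod>k\<in>{k \<in> {..<l}. n k < n j}. real (n j - n k))" by (simp add: F_def)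
  qed
  finally have v: "\<bar>vdm l n\<bar> = \<dots>" .
  \<comment> \<open>\<open>fact (n j)\<close> is the product of the distances from
    \<open>n j\<close> to all smaller numbers: those that are entries belong to the Vandermonde
    product, the others are gaps.\<close>
  show ?thesis
    unfolding v prod.distrib[symmetric]
  proof (rule prod.cong[OF refl])
    fix j assume "j \<in> {..<l}"
    let ?K = "{k \<in> {..<l}. n k < n j}"
    have "inj_on n ?K" by (rule inj_on_subset[OF inj]) auto
    then have "(\<Prod>k\<in>?K. real (n j - n k)) = (\<Prod>b\<in>n ` ?K. real (n j - b))" by (simp add: prod.reindex)
    then have "(\<Prod>k\<in>?K. real (n j - n k)) * (\<Prod>b\<in>{..<n j} - n ` {..<l}. real (n j - b)) =
        (\<Prod>b\<in>n ` ?K \<union> ({..<n j} - n ` {..<l}). real (n j - b))"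
      by (subst prod.union_disjoint) auto
    also have "n ` ?K \<union> ({..<n j} - n ` {..<l}) = {..<n j}" by auto
    also have "(\<Prod>b<n j. real (n j - b)) = fact (n j)"
      by (simp add: fact_prod_rev lessThan_atLeast0)
    finally show "(\<Prod>k\<in>?K. real (n j - n k)) * (\<Prod>b\<in>{..<n j} - n ` {..<l}. real (n j - b)) = fact (n j)" .
  qed
qed

lemma vdm_nonzero:
  assumes "inj_on n {..<l}"
  shows "vdm l n \<noteq> 0"
proof
  assume "vdm l n = 0"
  then have "(\<Prod>j<l. fact (n j) :: real) = 0" using abs_vdm_hooks[OF assms] by simp
  then show False by simp
qed

text \<open>A pair changes order exactly if it consists of \<open>j\<close> and an entry strictly
  between \<open>n j - p\<close> and \<open>n j\<close>.\<close>

lemma sgn_vdm_slide: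
  assumes j: "j < l" and pn: "p \<le> n j" and new: "\<And>k. k < l \<Longrightarrow> n k \<noteq> n j - p"
    and inj: "inj_on n {..<l}"
  shows "sgn (vdm l (n(j := n j - p))) = (-1) ^ card {k \<in> {..<l}. n j - p < n k \<and> n k < n j} * sgn (vdm l n)"
proof -
  let ?n' = "n(j := n j - p)"
  define r :: "nat \<Rightarrow> real" where "r k = (if n j - p < n k \<and> n k < n j then -1 else 1)" for k
  have sp: "sgn (pairs_prod l f) = pairs_prod l (\<lambda>i k. sgn (f i k))" for f :: "nat \<Rightarrow> nat \<Rightarrow> real"
  proof -
    have "sgn (\<Prod>x<m. g x) = (\<Prod>x<m. sgn (g x))" for g :: "nat \<Rightarrow> real" and m
      by (induction m) (auto simp: sgn_mult)
    then show ?thesis by (simp add: pairs_prod_def)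
  qed
  have "sgn (vdm l ?n') = pairs_prod l (\<lambda>i k. sgn (real (n k) - real (n i)) * (if i = j then r k else if k = j then r i else 1))"
    unfolding vdm_def sp
  proof (rule pairs_prod_cong)
    fix i k assume ik: "i < k" "k < l"
    then have "n i \<noteq> n k" using inj_onD[OF inj, of i k] by auto
    have core: "sgn (real (n b) - real (n j - p)) = sgn (real (n b) - real (n j)) * r b \<and>
      sgn (real (n j - p) - real (n b)) = sgn (real (n j) - real (n b)) * r b"
      if nb: "n b \<noteq> n j" "b < l" for b
    proof -
      have "n b \<noteq> n j - p" using new nb by simp
      then consider "n b < n j - p" | "n j - p < n b" "n b < n j" | "n j < n b"
        using nb(1) by linarith
      then show ?thesis using pn by cases (auto simp: r_def sgn_if)
    qed
    show "sgn (real (?n' k) - real (?n' i)) =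
        sgn (real (n k) - real (n i)) * (if i = j then r k else if k = j then r i else 1)"
    proof (cases "i = j")
      case True
      then show ?thesis using core[of k] \<open>n i \<noteq> n k\<close> ik by simp
    next
      case False
      then show ?thesis using core[of i] \<open>n i \<noteq> n k\<close> ik by auto
    qed
  qed
  also have "\<dots> = sgn (vdm l n) * (\<Prod>k\<in>{..<l} - {j}. r k)"
    unfolding pairs_prod_mult pairs_prod_through[OF j] vdm_def sp ..
  also have "(\<Prod>k\<in>{..<l} - {j}. r k) = (\<Prod>k\<in>{k \<in> {..<l}. n j - p < n k \<and> n k < n j}. -1)"
    by (rule prod.mono_neutral_cong_right) (auto simp: r_def)
  finally show ?thesis by (simp only: prod_constant mult.commute)
qed

section \<open>Beta numbers and hooks\<close>

definition part :: "nat list \<Rightarrow> nat \<Rightarrow> nat" where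
  "part lam i = (if i < length lam then lam ! i else 0)"

text \<open>The number \<open>l\<close> of beads is a parameter, so that \<open>lam\<close> and all
  partitions below it, which may have fewer rows, are described by vectors of one common length. For
  \<open>l = length lam\<close> this is the degree vector.\<close>

definition beta :: "nat \<Rightarrow> nat list \<Rightarrow> nat \<Rightarrow> nat" where
  "beta l lam i = part lam i + (l - Suc i)"

lemma part_antimono:
  assumes "is_partition lam" "i \<le> j"
  shows "part lam j \<le> part lam i"
proof (cases "j < length lam")
  case True
  then show ?thesis
    using assms by (auto simp: is_partition_def part_def sorted_rev_nth_mono)
qed (simp add: part_def)

lemma part_pos_iff:
  assumes "is_partition lam"
  shows "0 < part lam i \<longleftrightarrow> i < length lam"
proof
  assume "i < length lam"
  then have "lam ! i \<noteq> 0" using assms nth_mem[of i lam] unfolding is_partition_def by metis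
  then show "0 < part lam i" using \<open>i < length lam\<close> by (simp add: part_def)
qed (simp add: part_def split: if_splits)

lemma diagram_part: "diagram lam = {(i, j). j < part lam i}"
  by (auto simp: diagram_def part_def split: if_splits)

lemma diagram_Sigma: "length lam \<le> l \<Longrightarrow> diagram lam = (SIGMA i:{..<l}. {..<part lam i})"
  by (auto simp: diagram_def part_def split: if_splits)

lemma beta_strict_decreasing:
  assumes "is_partition lam" "i < j" "j < l"
  shows "beta l lam j < beta l lam i"
  using part_antimono[OF assms(1), of i j] assms by (simp add: beta_def)

lemma inj_on_beta:
  assumes "is_partition lam"
  shows "inj_on (beta l lam) {..<l}"
  using beta_strict_decreasing[OF assms, where l = l] by (intro linorder_inj_onI') force

lemma beta_less_iff:
  assumes "is_partition lam" "i < l" "j < l"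
  shows "beta l lam j < beta l lam i \<longleftrightarrow> i < j"
  using beta_strict_decreasing[OF assms(1), of i j l] beta_strict_decreasing[OF assms(1), of j i l] assms
  by (cases i j rule: linorder_cases) auto

lemma psize_part:
  assumes "length lam \<le> l"
  shows "psize lam = (\<Sum>i<l. part lam i)"
proof -
  have "psize lam = (\<Sum>i<length lam. part lam i)"
    unfolding psize_def sum_list_sum_nth by (intro sum.cong) (auto simp: part_def)
  also have "\<dots> = (\<Sum>i<l. part lam i)"
    using assms by (intro sum.mono_neutral_left) (auto simp: part_def)
  finally show ?thesis .
qed

lemma psize_beta:
  assumes "length lam \<le> l"
  shows "int (psize lam) = (\<Sum>j<l. int (beta l lam j) - int j)"
proof -
  have "(\<Sum>j<l. int (l - Suc j)) = (\<Sum>j<l. int j)"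
    by (rule sum.nat_diff_reindex)
  then show ?thesis
    unfolding psize_part[OF assms] by (simp only: beta_def of_nat_add of_nat_sum sum.distrib sum_subtractf)
qed

lemma degvec_beta:
  "length (degvec lam) = length lam"
  "j < length lam \<Longrightarrow> degvec lam ! j = beta (length lam) lam j"
  by (simp_all add: degvec_def beta_def part_def)

text \<open>Both sides say that the box \<open>(i, j)\<close> lies in the diagram: the rows longer
  than \<open>j\<close> form an initial segment.\<close>

lemma less_conj_part_iff:
  assumes "is_partition lam"
  shows "i < conj_part lam j \<longleftrightarrow> j < part lam i"
proof -
  define K where "K = {k. j < part lam k}"
  have K: "conj_part lam j = card K"
    unfolding conj_part_def K_def by (rule arg_cong[of _ _ card]) (auto simp: part_def)
  have fin: "finite K" by (rule finite_subset[of _ "{..<length lam}"]) (auto simp: K_def part_def split: if_splits)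
  have down: "i \<in> K" if "k \<in> K" "i \<le> k" for i k
    using part_antimono[OF assms that(2)] that(1) by (simp add: K_def)
  show ?thesis
  proof
    assume "i < conj_part lam j"
    then have "\<not> K \<subseteq> {..<i}" using card_mono[of "{..<i}" K] unfolding K by fastforce
    then obtain k where "k \<in> K" "k \<notin> {..<i}" by blast
    then have "k \<in> K" "i \<le> k" by simp_all
    then show "j < part lam i" using down[of k i] by (simp add: K_def)
  next
    assume "j < part lam i"
    then have "{..i} \<subseteq> K" using down[of i] by (auto simp: K_def)
    then have "card {..i} \<le> card K" by (rule card_mono[OF fin])
    then show "i < conj_part lam j" unfolding K by simp
  qed
qed

text \<open>Along the boundary path of the diagram the steps at row ends carry the beta numbers and
  the steps at column ends the labels \<open>lab j\<close>. A hook length is the difference of the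
  labels at its two ends.\<close>

lemma beta_gaps:
  assumes lam: "is_partition lam" and len: "length lam \<le> l" and i: "i < l"
  defines "lab \<equiv> \<lambda>j. l + j - conj_part lam j"
  shows "bij_betw lab {..<part lam i} ({..<beta l lam i} - beta l lam ` {..<l})"
    and "j < part lam i \<Longrightarrow> hook lam i j = beta l lam i - lab j"
proof -
  have cl: "conj_part lam j \<le> l" for j
    using less_conj_part_iff[OF lam, of l j] len by (simp add: part_def)
  have anti: "conj_part lam j' \<le> conj_part lam j" if "j \<le> j'" for j j'
    using less_conj_part_iff[OF lam, of "conj_part lam j"] that by (metis leI le_less_trans less_irrefl)
  \<comment> \<open>\<open>low\<close> and \<open>high\<close> together: the label of column
    \<open>j\<close> is below bead \<open>k\<close> exactly if \<open>(k, j)\<close> is a box, and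
    it never equals a bead.\<close>
  have low: "lab j < beta l lam k" if "j < part lam k" "k < l" for j k
    using less_conj_part_iff[OF lam, of k j] that cl[of j] unfolding lab_def beta_def by linarith
  have high: "beta l lam k < lab j" if "part lam k \<le> j" "k < l" for j k
    using less_conj_part_iff[OF lam, of k j] that cl[of j] unfolding lab_def beta_def by linarith
  show "hook lam i j = beta l lam i - lab j" if "j < part lam i"
    using less_conj_part_iff[OF lam, of i j] that i cl[of j]
    unfolding hook_def lab_def beta_def by (simp add: part_def split: if_splits)
  show "bij_betw lab {..<part lam i} ({..<beta l lam i} - beta l lam ` {..<l})"
  proof (rule bij_betw_imageI)
    have mono: "lab j < lab j'" if "j < j'" for j j'
      using anti[of j j'] cl[of j] that unfolding lab_def by linarith
    show inj: "inj_on lab {..<part lam i}"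
      by (rule linorder_inj_onI') (use mono in force)
    have "lab j \<noteq> beta l lam k" if "k < l" for j k
      using low[of j k] high[of k j] that by (cases "j < part lam k") auto
    then have sub: "lab ` {..<part lam i} \<subseteq> {..<beta l lam i} - beta l lam ` {..<l}"
      using low[OF _ i] by auto
    have "beta l lam ` {i<..<l} \<subseteq> {..<beta l lam i}"
      using beta_strict_decreasing[OF lam] by auto
    moreover have "{..<beta l lam i} - beta l lam ` {..<l} = {..<beta l lam i} - beta l lam ` {i<..<l}"
    proof -
      have "k \<in> {i<..<l}" if "k < l" "beta l lam k < beta l lam i" for k
        using beta_less_iff[OF lam i that(1)] that by simp
      then show ?thesis by auto
    qed
    \<comment> \<open>Equality of the two sets follows by counting: the beads below bead
      \<open>i\<close> are those of the later rows, which leaves \<open>part lam i\<close>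
      gaps.\<close>
    moreover have "card (beta l lam ` {i<..<l}) = l - Suc i"
    proof -
      have "{i<..<l} \<subseteq> {..<l}" by auto
      then show ?thesis using card_image[OF inj_on_subset[OF inj_on_beta[OF lam, of l]]] by simp
    qed
    ultimately have "card ({..<beta l lam i} - beta l lam ` {..<l}) = beta l lam i - (l - Suc i)"
      by (simp add: card_Diff_subset)
    also have "\<dots> = card (lab ` {..<part lam i})"
      using card_image[OF inj] by (simp add: beta_def)
    finally show "lab ` {..<part lam i} = {..<beta l lam i} - beta l lam ` {..<l}"
      using sub by (intro card_subset_eq) auto
  qed
qed

lemma hook_prod_beta:
  assumes lam: "is_partition lam" and len: "length lam \<le> l"
  shows "hook_prod lam = (\<Prod>i<l. \<Prod>b\<in>{..<beta l lam i} - beta l lam ` {..<l}. beta l lam i - b)"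
    and "hook_prod lam = hook_prod_non_pfold p lam *
      (\<Prod>i<l. \<Prod>b\<in>pfold_legs p (beta l lam ` {..<l}) (beta l lam i). beta l lam i - b)"
proof -
  \<comment> \<open>A general \<open>f\<close> serves both the product of all hook lengths and the
    product in which those not divisible by \<open>p\<close> are replaced by 1.\<close>
  have row: "(\<Prod>j<part lam i. f (hook lam i j)) =
      (\<Prod>b\<in>{..<beta l lam i} - beta l lam ` {..<l}. f (beta l lam i - b))"
    if i: "i < l" for i and f :: "nat \<Rightarrow> nat"
  proof -
    have "(\<Prod>j<part lam i. f (hook lam i j)) = (\<Prod>j<part lam i. f (beta l lam i - (l + j - conj_part lam j)))"
      using beta_gaps(2)[OF lam len i] by (intro prod.cong) auto
    also have "\<dots> = (\<Prod>b\<in>{..<beta l lam i} - beta l lam ` {..<l}. f (beta l lam i - b))"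
      by (rule prod.reindex_bij_betw[OF beta_gaps(1)[OF lam len i]])
    finally show ?thesis .
  qed
  have all: "(\<Prod>(i, j)\<in>diagram lam. f (hook lam i j)) =
      (\<Prod>i<l. \<Prod>b\<in>{..<beta l lam i} - beta l lam ` {..<l}. f (beta l lam i - b))" for f :: "nat \<Rightarrow> nat"
    unfolding diagram_Sigma[OF len] using row by (subst prod.Sigma[symmetric]) auto
  show "hook_prod lam = (\<Prod>i<l. \<Prod>b\<in>{..<beta l lam i} - beta l lam ` {..<l}. beta l lam i - b)"
    unfolding hook_prod_def by (rule all)
  have fin: "finite (diagram lam)" unfolding diagram_Sigma[OF order_refl] by auto
  have "hook_prod lam = (\<Prod>(i, j)\<in>diagram lam. (if \<not> p dvd hook lam i j then hook lam i j else 1) *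
      (if p dvd hook lam i j then hook lam i j else 1))"
    unfolding hook_prod_def by (intro prod.cong) auto
  also have "\<dots> = (\<Prod>(i, j)\<in>diagram lam. if \<not> p dvd hook lam i j then hook lam i j else 1) *
      (\<Prod>(i, j)\<in>diagram lam. if p dvd hook lam i j then hook lam i j else 1)"
    by (simp add: case_prod_beta prod.distrib)
  also have "(\<Prod>(i, j)\<in>diagram lam. if \<not> p dvd hook lam i j then hook lam i j else 1) = hook_prod_non_pfold p lam"
    unfolding hook_prod_non_pfold_def prod.inter_filter[OF fin] by (rule prod.cong) auto
  also have "(\<Prod>(i, j)\<in>diagram lam. if p dvd hook lam i j then hook lam i j else 1) =
      (\<Prod>i<l. \<Prod>b\<in>pfold_legs p (beta l lam ` {..<l}) (beta l lam i). beta l lam i - b)"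
    unfolding all[of "\<lambda>h. if p dvd h then h else 1"]
  proof (rule prod.cong[OF refl])
    fix i
    have "pfold_legs p (beta l lam ` {..<l}) (beta l lam i) =
        {b \<in> {..<beta l lam i} - beta l lam ` {..<l}. p dvd beta l lam i - b}"
      by (auto simp: pfold_legs_def)
    then show "(\<Prod>b\<in>{..<beta l lam i} - beta l lam ` {..<l}.
        if p dvd beta l lam i - b then beta l lam i - b else 1) =
        (\<Prod>b\<in>pfold_legs p (beta l lam ` {..<l}) (beta l lam i). beta l lam i - b)"
      by (simp only: prod.inter_filter finite_Diff finite_lessThan)
  qed
  finally show "hook_prod lam = hook_prod_non_pfold p lam *
      (\<Prod>i<l. \<Prod>b\<in>pfold_legs p (beta l lam ` {..<l}) (beta l lam i). beta l lam i - b)" .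
qed

section \<open>Border strips\<close>

lemma diagram_diff:
  assumes "length lam \<le> l"
  shows "diagram lam - diagram nu = (SIGMA i:{..<l}. {part nu i..<part lam i})"
  unfolding diagram_Sigma[OF assms] by (auto simp: diagram_part)

lemma cell_path_row:
  assumes "\<And>k. j \<le> k \<Longrightarrow> k \<le> j' \<Longrightarrow> (i, k) \<in> S" "j \<le> j'"
  shows "(\<lambda>x y. x \<in> S \<and> y \<in> S \<and> cell_adj x y)\<^sup>*\<^sup>* (i, j) (i, j')"
  using assms(2,1)
proof (induction j' rule: dec_induct)
  case (step m)
  have "(\<lambda>x y. x \<in> S \<and> y \<in> S \<and> cell_adj x y)\<^sup>*\<^sup>* (i, j) (i, m)"
    using step.IH step.prems by simp
  moreover have "(i, m) \<in> S \<and> (i, Suc m) \<in> S \<and> cell_adj (i, m) (i, Suc m)"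
    using step.prems step.hyps by (simp add: cell_adj_def)
  ultimately show ?case by (rule rtranclp.rtrancl_into_rtrancl)
qed simp

text \<open>Removing a border strip in rows \<open>a\<close> to \<open>b\<close> shifts the beads of
  rows \<open>a + 1\<close> to \<open>b\<close> one row up, so as a set the beads change only by
  bead \<open>a\<close> dropping by \<open>p\<close>. The beads it jumps over belong to the rows
  \<open>a + 1\<close> to \<open>b\<close>, and their number is the height.\<close>

lemma border_strip_imp_slide:
  assumes strip: "border_strip_removal p lam nu" and lam: "is_partition lam"
    and len: "length lam \<le> l" and p: "p > 0"
  obtains a where "a < l" "p \<le> beta l lam a" "\<forall>k<l. beta l lam k \<noteq> beta l lam a - p"
    "beta l nu ` {..<l} = (beta l lam)(a := beta l lam a - p) ` {..<l}"
    "strip_height lam nu = card {k \<in> {..<l}. beta l lam a - p < beta l lam k \<and> beta l lam k < beta l lam a}"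
    "length nu \<le> l" "is_partition nu"
proof -
  define f where "f = part lam"
  define g where "g = part nu"
  define D where "D = diagram lam - diagram nu"
  have nu: "is_partition nu" and sub: "diagram nu \<subseteq> diagram lam" and card: "card D = p"
    and conn: "cells_connected D" and no22: "no_2x2 D"
    using strip unfolding border_strip_removal_def D_def by simp_all
  have D: "(i, j) \<in> D \<longleftrightarrow> g i \<le> j \<and> j < f i" for i j
    by (auto simp: D_def diagram_part f_def g_def)
  have gf: "g i \<le> f i" for i
  proof (rule ccontr)
    assume "\<not> g i \<le> f i"
    then have "(i, f i) \<in> diagram nu" by (simp add: diagram_part g_def)
    then show False using sub by (auto simp: diagram_part f_def)
  qed
  have anti: "f j \<le> f i" "g j \<le> g i" if "i \<le> j" for i j
    using part_antimono[OF lam that] part_antimono[OF nu that] by (simp_all add: f_def g_def)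
  define R where "R = {i. g i < f i}"
  have Rl: "R \<subseteq> {..<length lam}" by (auto simp: R_def f_def part_def split: if_splits)
  have finR: "finite R" by (rule finite_subset[OF Rl]) simp
  have "D \<noteq> {}" using card p by auto
  then obtain i0 j0 where "(i0, j0) \<in> D" by auto
  then have "i0 \<in> R" using D by (simp add: R_def)
  then have neR: "R \<noteq> {}" by blast
  define a where "a = Min R"
  define b where "b = Max R"
  have aR: "a \<in> R" and bR: "b \<in> R" using finR neR by (simp_all add: a_def b_def)
  have out: "g i = f i" if "i < a \<or> b < i" for i
  proof -
    have "i \<notin> R" using that Min_le[OF finR, of i] Max_ge[OF finR, of i] unfolding a_def b_def by linarith
    then show ?thesis using gf[of i] by (simp add: R_def)
  qed
  have ab: "a \<le> b" using finR aR by (simp add: b_def)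
  have bl: "b < l" using Rl bR len by auto
  \<comment> \<open>The inequality from above holds since there is no 2 by 2 square, the one from
    below by connectedness.\<close>
  have overlap: "f (Suc i) = Suc (g i)" if i: "a \<le> i" "i < b" for i
  proof (rule antisym)
    show "f (Suc i) \<le> Suc (g i)"
    proof (rule ccontr)
      assume "\<not> f (Suc i) \<le> Suc (g i)"
      then have "(i, g i) \<in> D \<and> (Suc i, g i) \<in> D \<and> (i, Suc (g i)) \<in> D \<and> (Suc i, Suc (g i)) \<in> D"
        using anti(1)[of i "Suc i"] anti(2)[of i "Suc i"] unfolding D by linarith
      then show False using no22 unfolding no_2x2_def by blast
    qed
    show "Suc (g i) \<le> f (Suc i)"
    proof (rule ccontr)
      assume gap: "\<not> Suc (g i) \<le> f (Suc i)"
      let ?r = "\<lambda>x y. x \<in> D \<and> y \<in> D \<and> cell_adj x y"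
      have "(a, g a) \<in> D" "(b, g b) \<in> D" using aR bR by (auto simp: D R_def)
      then have "?r\<^sup>*\<^sup>* (a, g a) (b, g b)" using conn unfolding cells_connected_def by blast
      \<comment> \<open>If rows \<open>i\<close> and \<open>i + 1\<close> of the strip share no
        column, a path starting in row \<open>a\<close> cannot get below row
        \<open>i\<close>.\<close>
      then have "fst (b, g b) \<le> i"
      proof (induction rule: rtranclp_induct)
        case base
        then show ?case using i by simp
      next
        case (step y z)
        obtain y1 y2 z1 z2 where yz: "y = (y1, y2)" "z = (z1, z2)" by fastforce
        have h: "g y1 \<le> y2" "y2 < f y1" "g z1 \<le> z2" "z2 < f z1" "y1 \<le> i"
          using step D yz by auto
        have "z1 = y1 \<or> z2 = y2 \<and> (z1 = Suc y1 \<or> y1 = Suc z1)"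
          using step(2) yz by (auto simp: cell_adj_def)
        moreover have "\<not> (z2 = y2 \<and> z1 = Suc y1 \<and> y1 = i)"
          using h gap by auto
        ultimately show ?case using h(5) yz by auto
      qed
      then show False using i by simp
    qed
  qed
  have shift: "beta l nu i = beta l lam (Suc i)" if "a \<le> i" "i < b" for i
    using overlap[OF that] that bl unfolding beta_def f_def g_def by linarith
  have same: "beta l nu i = beta l lam i" if "i < a \<or> b < i" for i
    using out[OF that] by (simp add: beta_def f_def g_def)
  have "card D = (\<Sum>i<l. f i - g i)"
    unfolding D_def diagram_diff[OF len] f_def g_def by simp
  then have sum: "p + (\<Sum>i<l. g i) = (\<Sum>i<l. f i)"
    unfolding card using gf by (simp add: sum.distrib[symmetric])
  have lnu: "length nu \<le> l"
  proof (rule ccontr)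
    assume "\<not> length nu \<le> l"
    then have "0 < g l" using part_pos_iff[OF nu, of l] by (simp add: g_def)
    then show False using gf[of l] len by (simp add: f_def part_def)
  qed
  \<comment> \<open>The bead sums of \<open>lam\<close> and \<open>nu\<close> differ by
    \<open>p\<close>, and all beads except \<open>beta l lam a\<close> and
    \<open>beta l nu b\<close> cancel.\<close>
  have key: "beta l lam a = beta l nu b + p"
  proof -
    have "p + (\<Sum>i<l. beta l nu i) = (\<Sum>i<l. beta l lam i)"
      using sum unfolding beta_def sum.distrib f_def g_def by linarith
    moreover have s: "(\<Sum>i<l. h i) = (\<Sum>i<a. h i) + ((\<Sum>i=a..<Suc b. h i) + (\<Sum>i=Suc b..<l. h i))" for h :: "nat \<Rightarrow> nat"
      using ab bl sum.atLeastLessThan_concat[of a "Suc b" l h] sum.atLeastLessThan_concat[of 0 a l h]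
      by (simp add: lessThan_atLeast0 del: sum.op_ivl_Suc)
    moreover have "(\<Sum>i<a. beta l nu i) = (\<Sum>i<a. beta l lam i)"
      "(\<Sum>i=Suc b..<l. beta l nu i) = (\<Sum>i=Suc b..<l. beta l lam i)"
      using same by (auto intro!: sum.cong)
    ultimately have "p + (\<Sum>i=a..<Suc b. beta l nu i) = (\<Sum>i=a..<Suc b. beta l lam i)" by simp
    moreover have "(\<Sum>i=a..<Suc b. beta l lam i) = beta l lam a + (\<Sum>i=Suc a..<Suc b. beta l lam i)"
      using ab by (intro sum.atLeast_Suc_lessThan) simp
    moreover have "(\<Sum>i=Suc a..<Suc b. beta l lam i) = (\<Sum>i=a..<b. beta l lam (Suc i))"
      by (rule sum.shift_bounds_Suc_ivl)
    moreover have "(\<Sum>i=a..<Suc b. beta l nu i) = (\<Sum>i=a..<b. beta l lam (Suc i)) + beta l nu b"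
    proof -
      have "(\<Sum>i=a..<b. beta l nu i) = (\<Sum>i=a..<b. beta l lam (Suc i))" using shift by (intro sum.cong) auto
      then show ?thesis using ab by simp
    qed
    ultimately show ?thesis by simp
  qed
  have c: "beta l lam a - p = beta l nu b" using key by simp
  have new: "beta l lam k \<noteq> beta l nu b" if k: "k < l" for k
  proof -
    consider "k < a" | "k = a" | "a < k" "k \<le> b" | "b < k" by linarith
    then show ?thesis
    proof cases
      case 1
      then show ?thesis using same[of k] beta_strict_decreasing[OF nu, of k b l] ab bl by simp
    next
      case 2
      then show ?thesis using key p by simp
    next
      case 3
      then obtain m where "k = Suc m" "a \<le> m" "m < b" by (cases k) auto
      then show ?thesis using shift[of m] beta_strict_decreasing[OF nu, of m b l] bl by simp
    next
      case 4
      then show ?thesis using same[of k] beta_strict_decreasing[OF nu, of b k l] k by simp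
    qed
  qed
  have img: "beta l nu ` {..<l} = (beta l lam)(a := beta l nu b) ` {..<l}"
  proof (intro equalityI subsetI)
    fix x assume "x \<in> beta l nu ` {..<l}"
    then obtain i where i: "i < l" "x = beta l nu i" by auto
    consider "i < a \<or> b < i" | "a \<le> i" "i < b" | "i = b" by linarith
    then show "x \<in> (beta l lam)(a := beta l nu b) ` {..<l}"
    proof cases
      case 1
      then show ?thesis using i ab same[of i] by (intro image_eqI[of _ _ i]) auto
    next
      case 2
      then show ?thesis using i bl shift[of i] by (intro image_eqI[of _ _ "Suc i"]) auto
    next
      case 3
      then show ?thesis using i ab bl by (intro image_eqI[of _ _ a]) auto
    qed
  next
    fix x assume "x \<in> (beta l lam)(a := beta l nu b) ` {..<l}"
    then obtain i where i: "i < l" "x = ((beta l lam)(a := beta l nu b)) i" by auto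
    consider "i < a \<or> b < i" | "a < i" "i \<le> b" | "i = a" by linarith
    then show "x \<in> beta l nu ` {..<l}"
    proof cases
      case 1
      then show ?thesis using i ab same[of i] by (intro image_eqI[of _ _ i]) auto
    next
      case 2
      then obtain m where "i = Suc m" "a \<le> m" "m < b" by (cases i) auto
      then show ?thesis using i shift[of m] by (intro image_eqI[of _ _ m]) auto
    next
      case 3
      then show ?thesis using i bl by (intro image_eqI[of _ _ b]) auto
    qed
  qed
  have "{k \<in> {..<l}. beta l nu b < beta l lam k \<and> beta l lam k < beta l lam a} = {a<..b}"
  proof (intro equalityI subsetI)
    fix k assume k: "k \<in> {k \<in> {..<l}. beta l nu b < beta l lam k \<and> beta l lam k < beta l lam a}"
    then have "a < k" using beta_less_iff[OF lam, of a l k] ab bl by simp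
    moreover have "\<not> b < k" using k same[of k] beta_strict_decreasing[OF nu, of b k l] by auto
    ultimately show "k \<in> {a<..b}" by simp
  next
    fix k assume k: "k \<in> {a<..b}"
    then obtain m where m: "k = Suc m" "a \<le> m" "m < b" by (cases k) auto
    then have "beta l lam k = beta l nu m" using shift[of m] by simp
    moreover have "beta l nu b < beta l nu m" using m bl by (intro beta_strict_decreasing[OF nu]) auto
    ultimately show "k \<in> {k \<in> {..<l}. beta l nu b < beta l lam k \<and> beta l lam k < beta l lam a}"
      using k bl beta_strict_decreasing[OF lam, of a k l] by simp
  qed
  moreover have "fst ` D = {a..b}"
  proof (intro equalityI subsetI)
    fix i assume "i \<in> fst ` D"
    then obtain j where "(i, j) \<in> D" by auto
    then have "g i \<noteq> f i" using D by auto
    then show "i \<in> {a..b}" using out[of i] by fastforce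
  next
    fix i assume i: "i \<in> {a..b}"
    have "g i < f i"
    proof (cases "i = b")
      case False
      then show ?thesis using overlap[of i] anti(1)[of i "Suc i"] i by simp
    qed (use bR in \<open>simp add: R_def\<close>)
    then have "(i, g i) \<in> D" by (simp add: D)
    then show "i \<in> fst ` D" by force
  qed
  ultimately have ht: "strip_height lam nu =
      card {k \<in> {..<l}. beta l nu b < beta l lam k \<and> beta l lam k < beta l lam a}"
    unfolding strip_height_def D_def[symmetric] by simp
  show thesis
    by (rule that[of a]) (use ab bl key new img ht lnu nu in \<open>simp_all add: c\<close>)
qed

lemma sum_shift_telescope:
  fixes h :: "nat \<Rightarrow> nat"
  assumes "a \<le> b"
  shows "(\<Sum>i=a..<b. h i) + h b = h a + (\<Sum>i=a..<b. h (Suc i))"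
  using assms by (induction b rule: dec_induct) (auto simp: sum.atLeastLessThan_Suc)

text \<open>Only the existence of a strip is needed: it shows that no bead can move where a chain of
  removals stops.\<close>

lemma slide_imp_border_strip:
  assumes lam: "is_partition lam" and len: "length lam \<le> l" and p: "p > 0"
    and al: "a < l" and pa: "p \<le> beta l lam a"
    and new: "\<And>k. k < l \<Longrightarrow> beta l lam k \<noteq> beta l lam a - p"
  shows "\<exists>nu. border_strip_removal p lam nu"
proof -
  define f where "f = part lam"
  define c where "c = beta l lam a - p"
  have anti: "f j \<le> f i" if "i \<le> j" for i j
    using part_antimono[OF lam that] by (simp add: f_def)
  have f0: "f i = 0" if "l \<le> i" for i using that len by (simp add: f_def part_def)
  have bt: "beta l lam i = f i + (l - Suc i)" for i by (simp add: beta_def f_def)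
  have ca: "c + p = beta l lam a" using pa by (simp add: c_def)
  define B where "B = {k. k < l \<and> c < beta l lam k}"
  have finB: "finite B" by (simp add: B_def)
  have aB: "a \<in> B" using al ca p by (simp add: B_def)
  \<comment> \<open>The last row whose bead lies above the target \<open>c\<close>; the moved bead
    becomes bead \<open>b\<close> of the new partition.\<close>
  define b where "b = Max B"
  have bB: "b \<in> B" unfolding b_def using finB aB by (intro Max_in) auto
  have ab: "a \<le> b" unfolding b_def using finB aB by simp
  have bl: "b < l" and cb: "c < beta l lam b" using bB by (auto simp: B_def)
  have after: "beta l lam i < c" if "b < i" "i < l" for i
  proof -
    have "i \<notin> B" using that Max_ge[OF finB, of i] unfolding b_def by linarith
    then show ?thesis using that new[OF that(2)] by (simp add: B_def c_def)
  qed
  have cge: "f (Suc b) + (l - Suc b) \<le> c"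
  proof (cases "Suc b < l")
    case True
    then show ?thesis using after[of "Suc b"] bt[of "Suc b"] by simp
  next
    case False
    then show ?thesis using f0[of "Suc b"] by simp
  qed
  \<comment> \<open>The row lengths are forced by the beads: rows \<open>a\<close> to
    \<open>b - 1\<close> take over the bead of the next row, hence \<open>f (Suc i) - 1\<close>, and
    row \<open>b\<close> receives the bead \<open>c\<close>.\<close>
  define g where "g i = (if a \<le> i \<and> i < b then f (Suc i) - 1 else if i = b then c - (l - Suc b) else f i)" for i
  have fpos: "0 < f i" if "i \<le> b" for i
  proof -
    have "0 < f b" using cge cb bt[of b] by linarith
    then show ?thesis using anti[OF that] by simp
  qed
  have gmid: "f (Suc i) = Suc (g i)" if "a \<le> i" "i < b" for i
    using that fpos[of "Suc i"] by (simp add: g_def)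
  have gb: "g b + (l - Suc b) = c" using cge by (simp add: g_def)
  have gout: "g i = f i" if "i < a \<or> b < i" for i using that ab by (auto simp: g_def)
  have gbf: "g b < f b" using gb cb bt[of b] by linarith
  have glt: "g i < f i" if "a \<le> i" "i \<le> b" for i
  proof (cases "i = b")
    case False
    then show ?thesis using gmid[of i] anti[of i "Suc i"] that by simp
  qed (simp add: gbf)
  have gf: "g i \<le> f i" for i
    using glt[of i] gout[of i] by (cases "a \<le> i \<and> i \<le> b") auto
  have gstep: "g (Suc i) \<le> g i" for i
  proof -
    consider "i < a" | "a \<le> i" "i < b" | "i = b" | "b < i" by linarith
    then show ?thesis
    proof cases
      case 1
      then show ?thesis using gf[of "Suc i"] anti[of i "Suc i"] gout[of i] by simp
    next
      case 2
      then show ?thesis using glt[of "Suc i"] gmid[of i] by simp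
    next
      case 3
      then show ?thesis using gout[of "Suc i"] cge gb by simp
    next
      case 4
      then show ?thesis using gout[of i] gout[of "Suc i"] anti[of i "Suc i"] by simp
    qed
  qed
  have ganti: "g j \<le> g i" if "i \<le> j" for i j
    using lift_Suc_antimono_le[of g, OF gstep that] .
  \<comment> \<open>A partition as a list has no zero parts, so the list ends before the first zero
    of \<open>g\<close>.\<close>
  define m where "m = (LEAST i. g i = 0)"
  have g0: "g l = 0" using gf[of l] f0[of l] by simp
  have gm: "g m = 0" unfolding m_def by (rule LeastI[of _ l]) (rule g0)
  have mpos: "0 < g i" if "i < m" for i using not_less_Least[of i "\<lambda>i. g i = 0"] that by (simp add: m_def)
  define nu where "nu = map g [0..<m]"
  have pn: "part nu i = g i" for i
    using ganti[of m i] gm by (cases "i < m") (auto simp: nu_def part_def)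
  have nu: "is_partition nu"
  proof -
    have "sorted (rev nu)"
      unfolding sorted_rev_iff_nth_mono by (auto simp: nu_def intro: ganti)
    moreover have "0 \<notin> set nu" using mpos by (force simp: nu_def)
    ultimately show ?thesis by (simp add: is_partition_def)
  qed
  define D where "D = diagram lam - diagram nu"
  have D: "(i, j) \<in> D \<longleftrightarrow> g i \<le> j \<and> j < f i" for i j
    by (auto simp: D_def diagram_part pn f_def)
  have sub: "diagram nu \<subseteq> diagram lam"
    using gf unfolding diagram_part pn f_def by (fastforce dest: less_le_trans)
  have rows: "a \<le> i \<and> i \<le> b" if "(i, j) \<in> D" for i j
    using that gout[of i] D[of i j] by fastforce
  have card: "card D = p"
  proof -
    have s: "(\<Sum>i=a..<b. f i) + (\<Sum>i=a..<b. l - Suc i) = (\<Sum>i=a..<b. beta l lam i)"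
      by (simp only: bt sum.distrib)
    have "(\<Sum>i=a..<b. g i + (l - Suc i)) = (\<Sum>i=a..<b. beta l lam (Suc i))"
    proof (rule sum.cong[OF refl])
      fix i assume "i \<in> {a..<b}"
      then have "f (Suc i) = Suc (g i)" "Suc i < l" using gmid[of i] bl by simp_all
      then show "g i + (l - Suc i) = beta l lam (Suc i)" unfolding bt by linarith
    qed
    then have s': "(\<Sum>i=a..<b. g i) + (\<Sum>i=a..<b. l - Suc i) = (\<Sum>i=a..<b. beta l lam (Suc i))"
      by (simp only: sum.distrib)
    have "card D = (\<Sum>i<l. f i - g i)"
      unfolding D_def diagram_diff[OF len] by (simp add: f_def pn)
    also have "\<dots> = (\<Sum>i\<in>{a..<Suc b}. f i - g i)"
      using bl gout by (intro sum.mono_neutral_right) auto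
    also have "\<dots> = (\<Sum>i=a..<b. f i - g i) + (f b - g b)" using ab by simp
    also have "(\<Sum>i=a..<b. f i - g i) = (\<Sum>i=a..<b. f i) - (\<Sum>i=a..<b. g i)"
      using gf by (intro sum_subtractf_nat) auto
    finally have "card D = (\<Sum>i=a..<b. f i) - (\<Sum>i=a..<b. g i) + (f b - g b)" .
    moreover have "(\<Sum>i=a..<b. g i) \<le> (\<Sum>i=a..<b. f i)" using gf by (intro sum_mono) auto
    moreover have "(\<Sum>i=a..<b. beta l lam i) + beta l lam b = beta l lam a + (\<Sum>i=a..<b. beta l lam (Suc i))"
      using sum_shift_telescope[OF ab] by simp
    moreover have "f b + c = g b + beta l lam b" using gb bt[of b] by simp
    ultimately show ?thesis using s s' ca gbf by linarith
  qed
  have no22: "no_2x2 D"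
    unfolding no_2x2_def
  proof
    assume "\<exists>i j. (i, j) \<in> D \<and> (Suc i, j) \<in> D \<and> (i, Suc j) \<in> D \<and> (Suc i, Suc j) \<in> D"
    then obtain i j where ij: "(i, j) \<in> D" "(Suc i, Suc j) \<in> D" by blast
    then have "f (Suc i) = Suc (g i)" using rows[OF ij(1)] rows[OF ij(2)] by (intro gmid) auto
    then show False using ij by (simp add: D)
  qed
  let ?r = "\<lambda>x y. x \<in> D \<and> y \<in> D \<and> cell_adj x y"
  have sym: "?r\<^sup>*\<^sup>* y x" if "?r\<^sup>*\<^sup>* x y" for x y
    using that
  proof (induction rule: rtranclp_induct)
    case (step y z)
    then have "z \<in> D \<and> y \<in> D \<and> cell_adj z y" by (auto simp: cell_adj_def)
    then show ?case using step.IH by (rule converse_rtranclp_into_rtranclp)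
  qed simp
  have row: "?r\<^sup>*\<^sup>* (i, j) (i, j')" if "(i, j) \<in> D" "(i, j') \<in> D" for i j j'
  proof (cases "j \<le> j'")
    case True
    show ?thesis by (rule cell_path_row[OF _ True]) (use that in \<open>simp add: D\<close>)
  next
    case False
    then have "?r\<^sup>*\<^sup>* (i, j') (i, j)" by (intro cell_path_row) (use that in \<open>simp_all add: D\<close>)
    then show ?thesis by (rule sym)
  qed
  \<comment> \<open>Consecutive rows share exactly one column: row \<open>i\<close> starts in column
    \<open>g i\<close>, where row \<open>i + 1\<close> ends. Climbing through these columns connects
    every cell with the end of row \<open>a\<close>.\<close>
  have top: "?r\<^sup>*\<^sup>* (a + d, j) (a, f a - 1)" if "(a + d, j) \<in> D" for d j
    using that
  proof (induction d arbitrary: j)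
    case 0
    have "(a, f a - 1) \<in> D" using glt[of a] ab by (simp add: D)
    then show ?case using 0 row[of a j "f a - 1"] by simp
  next
    case (Suc d)
    have r: "a + d < b" using rows[OF Suc.prems] by simp
    let ?j = "g (a + d)"
    have below: "(Suc (a + d), ?j) \<in> D" using gmid[of "a + d"] gstep[of "a + d"] r by (simp add: D)
    have above: "(a + d, ?j) \<in> D" using glt[of "a + d"] r by (simp add: D)
    have "?r\<^sup>*\<^sup>* (Suc (a + d), j) (Suc (a + d), ?j)" using Suc.prems below by (intro row) simp_all
    moreover have "(Suc (a + d), ?j) \<in> D \<and> (a + d, ?j) \<in> D \<and> cell_adj (Suc (a + d), ?j) (a + d, ?j)"
      using below above by (simp add: cell_adj_def)
    ultimately have "?r\<^sup>*\<^sup>* (Suc (a + d), j) (a + d, ?j)" by (rule rtranclp.rtrancl_into_rtrancl)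
    also have "?r\<^sup>*\<^sup>* (a + d, ?j) (a, f a - 1)" by (rule Suc.IH[OF above])
    finally show ?case by simp
  qed
  have top': "?r\<^sup>*\<^sup>* x (a, f a - 1)" if "x \<in> D" for x
  proof -
    obtain i j where x: "x = (i, j)" by fastforce
    then have "a \<le> i" using rows[of i j] that by simp
    then obtain d where "i = a + d" using le_Suc_ex[of a i] by blast
    then show ?thesis using top[of d j] that x by simp
  qed
  have "cells_connected D"
    unfolding cells_connected_def
  proof (intro ballI)
    fix x y assume "x \<in> D" "y \<in> D"
    then show "?r\<^sup>*\<^sup>* x y" using rtranclp_trans[OF top'[of x] sym[OF top'[of y]]] by blast
  qed
  then have "border_strip_removal p lam nu"
    unfolding border_strip_removal_def D_def[symmetric] using nu sub card no22 by blast
  then show ?thesis ..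
qed

section \<open>Cores and quotients\<close>

lemma image_fun_upd_inj:
  assumes "inj_on f A" "j \<in> A"
  shows "(f(j := y)) ` A = insert y (f ` A - {f j})"
  using assms by (auto simp: inj_on_def image_iff)

lemma card_index_filter:
  assumes "inj_on n A"
  shows "card {k \<in> A. P (n k)} = card {x \<in> n ` A. P x}"
proof -
  have "{x \<in> n ` A. P x} = n ` {k \<in> A. P (n k)}" by auto
  moreover have "inj_on n {k \<in> A. P (n k)}" by (rule inj_on_subset[OF assms]) auto
  ultimately show ?thesis by (simp add: card_image)
qed

text \<open>\<open>n\<close> is only required to list the beads of \<open>lam\<close> in some
  class-decreasing order, since it is not sorted again after a move. Each strip contributes its
  height to the sign, and at the end no bead can move down by \<open>p\<close>.\<close>

lemma core_chain_slides:
  assumes "core_chain p lam core ht" "p > 0" "is_partition lam" "length lam \<le> l"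
    and "n ` {..<l} = beta l lam ` {..<l}" "class_decreasing p l n"
  shows "\<exists>m. class_decreasing p l m \<and> m ` {..<l} = beta l core ` {..<l} \<and>
    class_core p l m = class_core p l n \<and> sgn (vdm l m) = (-1) ^ ht * sgn (vdm l n) \<and>
    is_partition core \<and> length core \<le> l \<and>
    (\<forall>a<l. p \<le> beta l core a \<longrightarrow> beta l core a - p \<in> beta l core ` {..<l})"
  using assms
proof (induction arbitrary: n rule: core_chain.induct)
  case (stop p lam)
  have "beta l lam a - p \<in> beta l lam ` {..<l}" if "a < l" "p \<le> beta l lam a" for a
  proof (rule ccontr)
    assume "beta l lam a - p \<notin> beta l lam ` {..<l}"
    then have "beta l lam k \<noteq> beta l lam a - p" if "k < l" for k
      using that by (metis image_eqI lessThan_iff)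
    then have "\<exists>nu. border_strip_removal p lam nu"
      by (rule slide_imp_border_strip[OF stop.prems(2,3,1) that])
    then show False using stop.hyps by blast
  qed
  then show ?case using stop.prems by (intro exI[of _ n]) simp
next
  case (step p lam nu c h)
  note p = step.prems(1) and lam = step.prems(2) and len = step.prems(3) and img = step.prems(4) and cd = step.prems(5)
  obtain a where a: "a < l" "p \<le> beta l lam a" "\<forall>k<l. beta l lam k \<noteq> beta l lam a - p"
    and inu: "beta l nu ` {..<l} = (beta l lam)(a := beta l lam a - p) ` {..<l}"
    and ht: "strip_height lam nu = card {k \<in> {..<l}. beta l lam a - p < beta l lam k \<and> beta l lam k < beta l lam a}"
    and nu: "length nu \<le> l" "is_partition nu"
    by (rule border_strip_imp_slide[OF step.hyps(1) lam len p])
  have injn: "inj_on n {..<l}" by (rule class_decreasing_inj[OF cd])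
  have injb: "inj_on (beta l lam) {..<l}" by (rule inj_on_beta[OF lam])
  have "beta l lam a \<in> n ` {..<l}" using a(1) unfolding img by blast
  then obtain j where j: "j < l" "n j = beta l lam a" by force
  define n' where "n' = n(j := n j - p)"
  have new: "n k \<noteq> n j - p" if "k < l" for k
  proof -
    have "n k \<in> beta l lam ` {..<l}" using that unfolding img[symmetric] by blast
    then obtain k' where "k' < l" "n k = beta l lam k'" by auto
    then show ?thesis using a(3) unfolding j(2) by simp
  qed
  have pn: "p \<le> n j" using a(2) j(2) by simp
  have cd': "class_decreasing p l n'"
    unfolding n'_def by (rule class_decreasing_slide[OF p cd pn new])
  have img': "n' ` {..<l} = beta l nu ` {..<l}"
  proof -
    have "n' ` {..<l} = insert (n j - p) (n ` {..<l} - {n j})"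
      unfolding n'_def using j(1) by (intro image_fun_upd_inj[OF injn]) simp
    moreover have "beta l nu ` {..<l} = insert (beta l lam a - p) (beta l lam ` {..<l} - {beta l lam a})"
      unfolding inu using a(1) by (intro image_fun_upd_inj[OF injb]) simp
    ultimately show ?thesis by (simp only: img j(2))
  qed
  obtain m where m: "class_decreasing p l m" "m ` {..<l} = beta l c ` {..<l}"
    "class_core p l m = class_core p l n'" "sgn (vdm l m) = (-1) ^ h * sgn (vdm l n')"
    "is_partition c" "length c \<le> l"
    "\<forall>a<l. p \<le> beta l c a \<longrightarrow> beta l c a - p \<in> beta l c ` {..<l}"
    using step.IH[OF p nu(2,1) img' cd'] by blast
  \<comment> \<open>The count depends only on the set of beads, so the height, expressed through the
    sorted beads, may be read off from \<open>n\<close>.\<close>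
  have "card {k \<in> {..<l}. n j - p < n k \<and> n k < n j} = card {x \<in> n ` {..<l}. n j - p < x \<and> x < n j}"
    by (rule card_index_filter[OF injn])
  also have "\<dots> = card {x \<in> beta l lam ` {..<l}. beta l lam a - p < x \<and> x < beta l lam a}"
    by (simp only: img j(2))
  also have "\<dots> = strip_height lam nu"
    unfolding ht by (rule card_index_filter[OF injb, symmetric])
  finally have "card {k \<in> {..<l}. n j - p < n k \<and> n k < n j} = strip_height lam nu" .
  then have "sgn (vdm l n') = (-1) ^ strip_height lam nu * sgn (vdm l n)"
    unfolding n'_def using sgn_vdm_slide[OF j(1) pn new injn] by (simp only:)
  moreover have "class_core p l n' = class_core p l n"
    unfolding n'_def by (rule class_core_slide(1)[of p n j l, OF pn])
  ultimately show ?case using m by (intro exI[of _ m]) (simp add: power_add)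
qed

section \<open>The size of the quotient as a number of gaps\<close>

lemma class_weight_legs:
  assumes "p > 0" "class_decreasing p l n"
  shows "class_weight p l n = (\<Sum>a\<in>n ` {..<l}. card (pfold_legs p (n ` {..<l}) a))"
proof -
  have "class_weight p l n = (\<Sum>j<l. card (pfold_legs p (n ` {..<l}) (n j)))"
    unfolding class_weight_def
  proof (rule sum.cong[OF refl])
    fix j assume "j \<in> {..<l}"
    then show "n j div p - class_rank p l n j = card (pfold_legs p (n ` {..<l}) (n j))"
      using card_pfold_legs[OF assms, of j] by simp
  qed
  also have "\<dots> = (\<Sum>a\<in>n ` {..<l}. card (pfold_legs p (n ` {..<l}) a))"
    using sum.reindex[OF class_decreasing_inj[OF assms(2)], of "\<lambda>a. card (pfold_legs p (n ` {..<l}) a)"] by simp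
  finally show ?thesis .
qed

text \<open>Iterating the closure under \<open>a - p\<close> puts every position below
  \<open>a\<close> on its runner into \<open>B\<close>.\<close>

lemma pfold_legs_empty:
  assumes p: "p > 0" and down: "\<And>a. a \<in> B \<Longrightarrow> p \<le> a \<Longrightarrow> a - p \<in> B" and a: "a \<in> B"
  shows "pfold_legs p B a = {}"
proof -
  have "a - p * s \<in> B" if "p * s \<le> a" for s
    using that
  proof (induction s)
    case (Suc s)
    then have "a - p * s \<in> B" "p \<le> a - p * s" by simp_all
    then have "a - p * s - p \<in> B" by (rule down)
    then show ?case by (simp add: algebra_simps)
  qed (use a in simp)
  moreover have "\<exists>s. p * s \<le> a \<and> b = a - p * s" if "b < a" "p dvd a - b" for b
  proof -
    obtain s where "a - b = p * s" using \<open>p dvd a - b\<close> by blast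
    then show ?thesis using that(1) by (intro exI[of _ s]) auto
  qed
  ultimately show ?thesis by (fastforce simp: pfold_legs_def)
qed

text \<open>The gap \<open>k\<close> of the component corresponds to the gap
  \<open>p * k + i - t\<close> of the whole diagram. It is never negative, because all negative
  numbers belong to the Maya diagram.\<close>

lemma maya_count_legs:
  assumes p: "p > 0" and a: "int a + int t = int p * m + int i"
    and N: "N = {m. int p * m + int i - int t \<in> {x. x < 0} \<union> int ` B}"
  shows "maya_count N m = card (pfold_legs p B a)"
proof -
  define f where "f k = nat (int p * k + int i - int t)" for k
  have am: "int a = int p * m + int i - int t" using a by simp
  have "bij_betw f {k. k \<notin> N \<and> k < m} (pfold_legs p B a)"
  proof (rule bij_betw_imageI)
    have pos: "int (f k) = int p * k + int i - int t" "f k \<notin> B" if "k \<notin> N" for k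
    proof -
      have nn: "\<not> int p * k + int i - int t < 0" "int p * k + int i - int t \<notin> int ` B"
        using that unfolding N by auto
      then show e: "int (f k) = int p * k + int i - int t" by (simp add: f_def)
      show "f k \<notin> B" using nn(2) unfolding e[symmetric] by auto
    qed
    show "inj_on f {k. k \<notin> N \<and> k < m}"
    proof (rule inj_onI)
      fix x y assume xy: "x \<in> {k. k \<notin> N \<and> k < m}" "y \<in> {k. k \<notin> N \<and> k < m}" "f x = f y"
      then have "x \<notin> N" "y \<notin> N" by simp_all
      then have "int p * x = int p * y" using pos(1)[of x] pos(1)[of y] xy(3) by linarith
      then show "x = y" using p by simp
    qed
    show "f ` {k. k \<notin> N \<and> k < m} = pfold_legs p B a"
    proof (intro equalityI subsetI)
      fix b assume "b \<in> f ` {k. k \<notin> N \<and> k < m}"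
      then obtain k where k: "k \<notin> N" "k < m" "b = f k" by auto
      have d: "int a - int b = int p * (m - k)"
        using pos(1)[OF k(1)] k(3) am by (simp add: right_diff_distrib)
      moreover have "0 < int p * (m - k)" using k(2) p by simp
      ultimately have lt: "b < a" by linarith
      then have "int (a - b) = int p * (m - k)" using d by (simp add: of_nat_diff)
      then have "p dvd a - b" by (metis dvd_triv_left int_dvd_int_iff)
      then show "b \<in> pfold_legs p B a" using lt pos(2)[OF k(1)] k(3) by (simp add: pfold_legs_def)
    next
      fix b assume b: "b \<in> pfold_legs p B a"
      then have lt: "b < a" and nb: "b \<notin> B" and "p dvd a - b" by (auto simp: pfold_legs_def)
      then obtain s where s: "a - b = p * s" by blast
      have "s > 0" using s lt by (cases s) auto
      have e: "int p * (m - int s) + int i - int t = int b"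
      proof -
        have "int a - int b = int p * int s" using s lt by (metis less_imp_le of_nat_diff of_nat_mult)
        then show ?thesis using am by (simp add: right_diff_distrib)
      qed
      have "m - int s \<notin> N" unfolding N mem_Collect_eq e using nb by auto
      moreover have "f (m - int s) = b" unfolding f_def e by simp
      ultimately show "b \<in> f ` {k. k \<notin> N \<and> k < m}" using \<open>s > 0\<close> by (intro image_eqI[of _ _ "m - int s"]) auto
    qed
  qed
  then show ?thesis unfolding maya_count_def by (rule bij_betw_same_card)
qed

text \<open>The shift \<open>t\<close> only decides which runner becomes component \<open>i\<close>.
  The total counts all gaps below beads on the same runner, so it does not depend on
  \<open>t\<close>.\<close>

lemma quotient_size_legs:
  fixes p t :: nat and lam :: "nat list"
  assumes p: "p > 0"
  defines "B \<equiv> set (degvec lam)"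
  shows "quotient_size (p_quotient p t lam) = (\<Sum>a\<in>B. card (pfold_legs p B a))"
proof -
  define N where "N i = {m. int p * m + int i - int t \<in> {x. x < 0} \<union> int ` B}" for i
  define C where "C i = {a \<in> B. (a + t) mod p = i}" for i
  have finB: "finite B" by (simp add: B_def)
  have N': "{m. int p * m + int i \<in> (\<lambda>m. m + int t) ` maya lam} = N i" for i
  proof -
    have "x \<in> (\<lambda>m. m + int t) ` maya lam \<longleftrightarrow> x - int t \<in> maya lam" for x
      by (auto intro!: image_eqI[of _ _ "x - int t"])
    then show ?thesis by (simp add: N_def maya_def B_def)
  qed
  have part: "sum_mset (maya_partition (N i)) = (\<Sum>a\<in>C i. card (pfold_legs p B a))" if i: "i < p" for i
  proof -
    define \<phi> where "\<phi> a = int ((a + t) div p)" for a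
    have phi: "int a + int t = int p * \<phi> a + int i" if "a \<in> C i" for a
    proof -
      have "a + t = p * ((a + t) div p) + i" using that mult_div_mod_eq[of p "a + t"] by (simp add: C_def)
      then show ?thesis unfolding \<phi>_def by (metis of_nat_add of_nat_mult)
    qed
    have count: "maya_count (N i) (\<phi> a) = card (pfold_legs p B a)" if "a \<in> C i" for a
      using phi[OF that] by (intro maya_count_legs[OF p]) (auto simp: N_def)
    have inj: "inj_on \<phi> (C i)"
    proof (rule inj_onI)
      fix x y assume "x \<in> C i" "y \<in> C i" "\<phi> x = \<phi> y"
      then show "x = y" using phi[of x] phi[of y] by simp
    qed
    \<comment> \<open>Elements stemming from the negative part have no gap below them, so every part
      of the component belongs to a genuine bead.\<close>
    have mem: "m \<in> \<phi> ` C i" if m: "m \<in> N i" "0 < maya_count (N i) m" for m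
    proof -
      have "\<not> int p * m + int i - int t < 0"
      proof
        assume neg: "int p * m + int i - int t < 0"
        have "k \<in> N i" if "k < m" for k
        proof -
          have "int p * k \<le> int p * m" using that p by (intro mult_left_mono) auto
          then show ?thesis using neg by (simp add: N_def)
        qed
        then have "{k. k \<notin> N i \<and> k < m} = {}" by auto
        then have "maya_count (N i) m = 0" unfolding maya_count_def by (simp only: card.empty)
        then show False using m(2) by simp
      qed
      then obtain a where a: "a \<in> B" "int p * m + int i - int t = int a"
        using m(1) by (auto simp: N_def)
      then have e: "int (a + t) = int i + int p * m" by simp
      have "int ((a + t) mod p) = int i" unfolding zmod_int e using i by simp
      then have "a \<in> C i" using a by (simp add: C_def)
      moreover have "\<phi> a = m" using phi[OF \<open>a \<in> C i\<close>] e p by simp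
      ultimately show ?thesis by blast
    qed
    have in_N: "\<phi> a \<in> N i" if "a \<in> C i" for a
    proof -
      have "int p * \<phi> a + int i - int t = int a" using phi[OF that] by simp
      then show ?thesis using that by (simp add: N_def C_def)
    qed
    have "sum_mset (maya_partition (N i)) = (\<Sum>m\<in>{m \<in> N i. 0 < maya_count (N i) m}. maya_count (N i) m)"
      unfolding maya_partition_def by (simp only: sum_unfold_sum_mset)
    \<comment> \<open>Beads with nothing missing below them give no part, but may be added to the
      sum with value 0.\<close>
    also have "\<dots> = (\<Sum>m\<in>\<phi> ` C i. maya_count (N i) m)"
      using mem in_N finB by (intro sum.mono_neutral_left) (auto simp: C_def)
    also have "\<dots> = (\<Sum>a\<in>C i. card (pfold_legs p B a))"
      unfolding sum.reindex[OF inj] by (rule sum.cong) (auto simp: count)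
    finally show ?thesis .
  qed
  have "quotient_size (p_quotient p t lam) = (\<Sum>i<p. sum_mset (maya_partition (N i)))"
    unfolding quotient_size_def p_quotient_def Let_def N'
    by (simp add: comp_def sum_set_upt_conv_sum_list_nat[symmetric] lessThan_atLeast0 interv_sum_list_conv_sum_set_nat)
  also have "\<dots> = (\<Sum>i<p. \<Sum>a\<in>C i. card (pfold_legs p B a))"
    by (rule sum.cong) (auto simp: part)
  also have "\<dots> = (\<Sum>a\<in>B. card (pfold_legs p B a))"
    unfolding C_def using finB p by (intro sum.group) auto
  finally show ?thesis .
qed

section \<open>Wronskians and assembly of the factorisation\<close>

lemma vandermonde_diff_vdm:
  "vandermonde_diff ns = vdm (length ns) (\<lambda>j. ns ! j)"
proof -
  have "{(i, j). i < j \<and> j < length ns} = (SIGMA i:{..<length ns}. {i<..<length ns})" by auto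
  then show ?thesis
    unfolding vandermonde_diff_def vdm_def pairs_prod_swap by (simp add: prod.Sigma)
qed

lemma pderiv_power_hpoly:
  assumes "p > 0"
  shows "(pderiv ^^ i) (smult c (hpoly p k)) = smult c (hpoly p (k - int i))"
  by (induction i) (simp_all add: pderiv_smult pderiv_hpoly[OF assms] algebra_simps)

lemma smult_sum_right: "smult c (\<Sum>i\<in>S. f i) = (\<Sum>i\<in>S. smult c (f i))"
  by (induction S rule: infinite_finite_induct) (simp_all add: smult_add_right)

lemma wronskian_qpolys:
  assumes "p \<ge> 2"
  shows "wronskian (map (qpolys p) ns) =
    smult (\<Prod>j<length ns. fact (ns ! j)) (jt (hpoly p) (length ns) (\<lambda>j. int (ns ! j)))"
proof -
  define l where "l = length ns"
  have entry: "(pderiv ^^ i) (qpolys p k) = smult (fact k) (hpoly p (int k - int i))" for i k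
    using assms by (simp add: qpolys_eq pderiv_power_hpoly)
  have "wronskian (map (qpolys p) ns) =
      det (mat l l (\<lambda>(i, j). smult (fact (ns ! j)) (hpoly p (int (ns ! j) - int i))))"
    unfolding wronskian_def l_def
    by (intro arg_cong[of _ _ det] eq_matI) (auto simp: entry)
  also have "\<dots> = (\<Sum>\<sigma> | \<sigma> permutes {0..<l}. smult (\<Prod>j<l. fact (ns ! j))
      (signof \<sigma> * (\<Prod>i=0..<l. hpoly p (int (ns ! \<sigma> i) - int i))))"
    unfolding det_def'[OF mat_carrier]
  proof (rule sum.cong[OF refl])
    fix \<sigma> assume "\<sigma> \<in> {\<sigma>. \<sigma> permutes {0..<l}}"
    then have \<sigma>: "\<sigma> permutes {0..<l}" by simp
    have lt: "\<sigma> i < l" if "i < l" for i using that permutes_in_image[OF \<sigma>, of i] by simp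
    have "(\<Prod>i=0..<l. mat l l (\<lambda>(i, j). smult (fact (ns ! j)) (hpoly p (int (ns ! j) - int i))) $$ (i, \<sigma> i)) =
        (\<Prod>i=0..<l. smult (fact (ns ! \<sigma> i)) (hpoly p (int (ns ! \<sigma> i) - int i)))"
      using lt by (intro prod.cong) auto
    also have "\<dots> = smult (\<Prod>i=0..<l. fact (ns ! \<sigma> i)) (\<Prod>i=0..<l. hpoly p (int (ns ! \<sigma> i) - int i))"
      by (rule prod_smult)
    also have "(\<Prod>i=0..<l. fact (ns ! \<sigma> i) :: real) = (\<Prod>j<l. fact (ns ! j))"
      using prod.permute[OF \<sigma>, of "\<lambda>j. fact (ns ! j) :: real"] by (simp add: lessThan_atLeast0 comp_def)
    finally show "signof \<sigma> * (\<Prod>i=0..<l. mat l l (\<lambda>(i, j). smult (fact (ns ! j)) (hpoly p (int (ns ! j) - int i))) $$ (i, \<sigma> i)) =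
        smult (\<Prod>j<l. fact (ns ! j)) (signof \<sigma> * (\<Prod>i=0..<l. hpoly p (int (ns ! \<sigma> i) - int i)))"
      by simp
  qed
  also have "\<dots> = smult (\<Prod>j<l. fact (ns ! j)) (jt (hpoly p) l (\<lambda>j. int (ns ! j)))"
    unfolding jt_leibniz smult_sum_right ..
  finally show ?thesis by (simp add: l_def)
qed

lemma poly_in_monom_power:
  fixes q :: "'a :: comm_ring_1 poly"
  assumes p: "p > 0" and supp: "\<And>k. coeff q k \<noteq> 0 \<Longrightarrow> \<exists>s\<le>w. k = \<kappa> + p * s"
  shows "q = monom 1 \<kappa> * ((\<Sum>s\<le>w. monom (coeff q (\<kappa> + p * s)) s) \<circ>\<^sub>p monom 1 p)"
proof (rule poly_eqI)
  fix k
  have mp: "monom c s \<circ>\<^sub>p monom 1 p = monom c (p * s)" for c :: 'a and s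
    by (induction s) (simp_all add: monom_0 monom_Suc pcompose_pCons mult_monom)
  have "monom 1 \<kappa> * ((\<Sum>s\<le>w. monom (coeff q (\<kappa> + p * s)) s) \<circ>\<^sub>p monom 1 p) =
      (\<Sum>s\<le>w. monom (coeff q (\<kappa> + p * s)) (\<kappa> + p * s))"
    by (simp add: pcompose_sum mp sum_distrib_left mult_monom)
  then have c: "coeff (monom 1 \<kappa> * ((\<Sum>s\<le>w. monom (coeff q (\<kappa> + p * s)) s) \<circ>\<^sub>p monom 1 p)) k =
      (\<Sum>s\<le>w. if \<kappa> + p * s = k then coeff q (\<kappa> + p * s) else 0)"
    by (simp add: coeff_sum)
  show "coeff q k = coeff (monom 1 \<kappa> * ((\<Sum>s\<le>w. monom (coeff q (\<kappa> + p * s)) s) \<circ>\<^sub>p monom 1 p)) k"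
  proof (cases "\<exists>s\<le>w. k = \<kappa> + p * s")
    case True
    then obtain r where r: "r \<le> w" "k = \<kappa> + p * r" by blast
    have "(\<Sum>s\<le>w. if \<kappa> + p * s = k then coeff q (\<kappa> + p * s) else 0) = (\<Sum>s\<le>w. if s = r then coeff q k else 0)"
      using r p by (intro sum.cong) auto
    then show ?thesis unfolding c using r by simp
  next
    case False
    then have "(\<Sum>s\<le>w. if \<kappa> + p * s = k then coeff q (\<kappa> + p * s) else 0) = 0"
      by (intro sum.neutral) auto
    moreover have "coeff q k = 0" using False supp by blast
    ultimately show ?thesis unfolding c by simp
  qed
qed

theorem theorem7p2:
  fixes p :: nat and lam core :: "nat list" and ht t :: nat
  assumes "p \<ge> 2"
    and "is_partition lam"
    and "core_chain p lam core ht"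
  shows "\<exists>R :: real poly.
           q_part p lam = monom 1 (psize core) * (R \<circ>\<^sub>p monom 1 p) \<and>
           lead_coeff R = 1 \<and>
           degree R = quotient_size (p_quotient p t lam) \<and>
           poly R 0 \<noteq> 0 \<and>
           poly R 0 = (-1) ^ (ht + (psize lam - psize core) div p) *
                      real (hook_prod_non_pfold p lam) / real (hook_prod core)"
proof -
  have p: "p > 0" using assms(1) by simp
  define l where "l = length lam"
  define n where "n = beta l lam"
  define F where "F = (\<Prod>j<l. fact (n j) :: real)"
  define S where "S n = jt (hpoly p) l (\<lambda>j. int (n j))" for n
  define \<kappa> where "\<kappa> = psize core"
  define w where "w = class_weight p l n"
  have cd: "class_decreasing p l n"
    using beta_strict_decreasing[OF assms(2)] by (simp add: class_decreasing_def n_def)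
  have injn: "inj_on n {..<l}" by (rule class_decreasing_inj[OF cd])
  obtain m where m: "class_decreasing p l m" "m ` {..<l} = beta l core ` {..<l}"
    "class_core p l m = class_core p l n" "sgn (vdm l m) = (-1) ^ ht * sgn (vdm l n)"
    and core: "is_partition core" "length core \<le> l"
    and stuck: "\<forall>a<l. p \<le> beta l core a \<longrightarrow> beta l core a - p \<in> beta l core ` {..<l}"
    using core_chain_slides[OF assms(3) p assms(2), of l n] cd by (auto simp: l_def n_def)
  have injm: "inj_on m {..<l}" by (rule class_decreasing_inj[OF m(1)])
  \<comment> \<open>\<open>m\<close> lists the beads of the core in an order that need not be the
    sorted one. Sums and hook products may be transferred to \<open>beta l core\<close>, whereas
    \<open>vdm l m\<close> has to keep its sign.\<close>
  have reindex: "(\<Sum>j<l. f (m j)) = (\<Sum>j<l. f (beta l core j))" for f :: "nat \<Rightarrow> int"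
    using sum.reindex[OF injm, of f] sum.reindex[OF inj_on_beta[OF core(1), of l], of f] m(2) by simp
  have legs0: "pfold_legs p (m ` {..<l}) a = {}" if "a \<in> m ` {..<l}" for a
    using stuck that unfolding m(2) by (intro pfold_legs_empty[OF p]) auto
  \<comment> \<open>No bead of the core has a gap below it on its runner, so \<open>m\<close> is
    completely pushed down and agrees with \<open>class_core p l n\<close>. This identifies the core
    reached by removing strips.\<close>
  have "class_weight p l m = 0"
    unfolding class_weight_legs[OF p m(1)] using legs0 by simp
  then have mc: "m j = class_core p l n j" if "j < l" for j
    using class_weight_eq_0(1)[OF p m(1) _ that] m(3) by simp
  have km: "int \<kappa> = (\<Sum>j<l. int (m j) - int j)"
    unfolding \<kappa>_def psize_beta[OF core(2)] sum_subtractf reindex ..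
  then have kc: "int \<kappa> = (\<Sum>j<l. int (class_core p l n j) - int j)"
    using mc by simp
  have top: "int (\<kappa> + p * w) = (\<Sum>j<l. int (n j) - int j)"
    using class_weight_total[OF p cd] kc unfolding w_def by (simp add: sum_subtractf flip: of_nat_sum)
  have "int (psize lam) = (\<Sum>j<l. int (n j) - int j)"
    unfolding n_def by (rule psize_beta) (simp add: l_def)
  also note top[symmetric]
  finally have size: "psize lam = \<kappa> + p * w" by (simp only: of_nat_eq_iff)
  have low: "(\<forall>k. coeff (S n) k \<noteq> 0 \<longrightarrow> (\<exists>s\<le>w. k = \<kappa> + p * s)) \<and>
      coeff (S n) \<kappa> = coeff (S (class_core p l n)) \<kappa> * (-1) ^ w * class_vdm p l n"
    unfolding S_def w_def by (rule jt_hpoly_lowest[OF p cd kc])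
  have "S (class_core p l n) = S m" unfolding S_def using mc by (intro jt_cong) simp
  \<comment> \<open>For the core vector \<kappa> is the top exponent, so the formula for the top
    coefficient gives the value.\<close>
  then have core_coeff: "coeff (S (class_core p l n)) \<kappa> = vdm l m / (\<Prod>j<l. fact (m j))"
    unfolding S_def using coeff_jt_hpoly_top[OF p km] by simp

  have q: "q_part p lam = smult (F / vdm l n) (S n)"
  proof -
    have dv: "degvec lam ! j = n j" if "j < l" for j
      using that degvec_beta(2)[of j lam] by (simp add: l_def n_def)
    have "vandermonde_diff (degvec lam) = vdm l n"
      unfolding vandermonde_diff_vdm degvec_beta(1) l_def[symmetric] vdm_def
      by (rule pairs_prod_cong) (simp add: dv)
    moreover have "jt (hpoly p) l (\<lambda>j. int (degvec lam ! j)) = S n"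
      unfolding S_def by (rule jt_cong) (simp add: dv)
    moreover have "(\<Prod>j<l. fact (degvec lam ! j)) = F"
      unfolding F_def by (rule prod.cong) (simp_all add: dv)
    ultimately show ?thesis
      unfolding q_part_def wronskian_qpolys[OF assms(1)] degvec_beta(1) l_def[symmetric] by simp
  qed
  have vn: "vdm l n \<noteq> 0" and vm: "vdm l m \<noteq> 0" by (rule vdm_nonzero[OF injn], rule vdm_nonzero[OF injm])
  have F: "F \<noteq> 0" by (simp add: F_def)

  \<comment> \<open>The product of the hook lengths of \<open>lam\<close> that are divisible by
    \<open>p\<close>.\<close>
  define L where "L = (\<Prod>j<l. \<Prod>b\<in>pfold_legs p (n ` {..<l}) (n j). real (n j - b))"
  have vdmL: "class_vdm p l n * L = 1" unfolding L_def by (rule class_vdm_legs[OF p cd])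
  have hn: "\<bar>vdm l n\<bar> * real (hook_prod lam) = F"
    using abs_vdm_hooks[OF injn] hook_prod_beta(1)[OF assms(2), of l] by (simp add: F_def n_def l_def)
  have hL: "real (hook_prod lam) = real (hook_prod_non_pfold p lam) * L"
    using hook_prod_beta(2)[OF assms(2), of l p] by (simp add: L_def n_def l_def)
  have hm: "\<bar>vdm l m\<bar> * real (hook_prod core) = (\<Prod>j<l. fact (m j))"
  proof -
    have "(\<Prod>j<l. \<Prod>b\<in>{..<m j} - m ` {..<l}. real (m j - b)) = real (hook_prod core)"
      using prod.reindex[OF injm, of "\<lambda>a. \<Prod>b\<in>{..<a} - m ` {..<l}. real (a - b)"]
        prod.reindex[OF inj_on_beta[OF core(1), of l], of "\<lambda>a. \<Prod>b\<in>{..<a} - m ` {..<l}. real (a - b)"]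
        hook_prod_beta(1)[OF core] m(2) by simp
    then show ?thesis using abs_vdm_hooks[OF injm] by simp
  qed
  have hc0: "real (hook_prod core) \<noteq> 0"
  proof
    assume "real (hook_prod core) = 0"
    then have "(\<Prod>j<l. fact (m j) :: real) = 0" using hm by simp
    then show False by simp
  qed
  have hp0: "real (hook_prod_non_pfold p lam) \<noteq> 0" using hn hL F by auto

  define R where "R = (\<Sum>s\<le>w. monom (coeff (q_part p lam) (\<kappa> + p * s)) s)"
  have Rc: "coeff R s = (if s \<le> w then coeff (q_part p lam) (\<kappa> + p * s) else 0)" for s
    by (simp add: R_def coeff_sum)
  have "q_part p lam = monom 1 (psize core) * (R \<circ>\<^sub>p monom 1 p)"
    unfolding R_def \<kappa>_def[symmetric]
  proof (rule poly_in_monom_power[OF p])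
    fix k assume "coeff (q_part p lam) k \<noteq> 0"
    then have "coeff (S n) k \<noteq> 0" unfolding q by simp
    then show "\<exists>s\<le>w. k = \<kappa> + p * s" using low by blast
  qed
  moreover have Rw: "coeff R w = 1"
    using coeff_jt_hpoly_top[OF p top] vn F by (simp add: Rc q S_def F_def)
  moreover have deg: "degree R = w"
  proof (rule antisym)
    show "degree R \<le> w" by (rule degree_le) (simp add: Rc)
    show "w \<le> degree R" by (rule le_degree) (simp add: Rw)
  qed
  moreover have "w = quotient_size (p_quotient p t lam)"
  proof -
    have "set (degvec lam) = n ` {..<l}"
      unfolding set_conv_nth l_def n_def by (force simp: degvec_beta)
    then show ?thesis unfolding w_def class_weight_legs[OF p cd] quotient_size_legs[OF p] by simp
  qed
  moreover have R0: "poly R 0 = (-1) ^ (ht + (psize lam - psize core) div p) *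
      real (hook_prod_non_pfold p lam) / real (hook_prod core)"
  proof -
    have div: "(psize lam - psize core) div p = w" using size p by (simp add: \<kappa>_def)
    have sg: "sgn x * sgn x = 1" if "x \<noteq> 0" for x :: real
      using that by (simp add: sgn_if)
    \<comment> \<open>Normalisation, core coefficient and class factor contribute the hook product
      of \<open>lam\<close>, the inverse hook product of the core and the inverse of
      \<open>L\<close>, up to the signs of the two Vandermonde products.\<close>
    have "F / vdm l n = sgn (vdm l n) * real (hook_prod lam)"
      using vn unfolding hn[symmetric] by (simp add: sgn_if)
    moreover have "vdm l m / (\<Prod>j<l. fact (m j)) = sgn (vdm l m) / real (hook_prod core)"
      using vm hc0 unfolding hm[symmetric] by (simp add: sgn_if)
    moreover have "real (hook_prod lam) * class_vdm p l n = real (hook_prod_non_pfold p lam)"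
      unfolding hL using vdmL by (simp add: mult.commute mult.left_commute)
    ultimately have "coeff (q_part p lam) \<kappa> = sgn (vdm l n) * sgn (vdm l m) * (-1) ^ w *
        real (hook_prod_non_pfold p lam) / real (hook_prod core)"
      unfolding q coeff_smult using low core_coeff by (simp add: algebra_simps)
    \<comment> \<open>The sign of \<open>vdm l n\<close> occurs twice and cancels, which leaves the
      sign collected along the chain of strips.\<close>
    also have "sgn (vdm l n) * sgn (vdm l m) = (-1) ^ ht"
      unfolding m(4) using sg[OF vn] by (simp add: mult.left_commute)
    finally show ?thesis unfolding div by (simp add: poly_0_coeff_0 Rc power_add)
  qed
  moreover have "poly R 0 \<noteq> 0" unfolding R0 using hc0 hp0 by simp
  ultimately show ?thesis by (intro exI[of _ R]) simp
qed

end
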